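(* Let $\alpha=(a_1,\ldots,a_k)$ be a composition of a non-negative integer $n$. Then \[(\zeta^{-1})_-(F_\alpha)=\frac{(-1)^{n+p_-(\tilde\alpha)}}{2^{2\lfloor n/2\rfloor}}\,C\bigl(p_-(\tilde\alpha),\lfloor n/2\rfloor-p_-(\tilde\alpha)\bigr),\] \[(\zeta^{-1})_+(F_\alpha)=\begin{cases}\dfrac{(-1)^{p_+(\alpha')}}{2^n}\,C\bigl(p_+(\alpha'),n/2-p_+(\alpha')\bigr)&\text{if } n\text{ is even},\\0&\text{if } n\text{ is odd.}\end{cases}\]
   Context: $\Bbbk$ is a field of characteristic $\neq2$. A composition $\alpha=(a_1,\ldots,a_k)$ of $n$ is a sequence of positive integers with sum $n$; its descent set is $D(\alpha)=\{a_1,a_1+a_2,\ldots,a_1+\cdots+a_{k-1}\}\subseteq\{1,\ldots,n-1\}$, which determines $\alpha$. $\tilde\alpha=(a_k,\ldots,a_1)$ is the reversal, and the conjugate $\alpha'$ is the composition of $n$ with $D(\alpha')=\{1,\ldots,n-1\}\setminus\{n-d: d\in D(\alpha)\}$ (its ribbon diagram is the reflection of that of $\alpha$ in the line $y=x$). Statistics: $p_-(\alpha)=\#\{i\ne k: a_i>1\}$; $p_+(\alpha)=1+\#\{i\ne1,k: a_i>1\}$ if $k>1$, $p_+(\alpha)=0$ if $k\le1$. ${\mathcal{Q}Sym}$ is the graded connected Hopf algebra of quasi-symmetric functions over $\Bbbk$, with monomial basis $M_\alpha=\sum_{i_1<\cdots<i_k}x_{i_1}^{a_1}\cdots x_{i_k}^{a_k}$,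 fundamental basis $F_\alpha=\sum_{\beta\ge\alpha}M_\beta$ ($\beta\ge\alpha$: $\beta$ refines $\alpha$), ordinary product, coproduct $\Delta(M_\alpha)=\sum_{i=0}^kM_{(a_1,\ldots,a_i)}\otimes M_{(a_{i+1},\ldots,a_k)}$. Convolution $\rho\psi=m\circ(\rho\otimes\psi)\circ\Delta$; characters (algebra morphisms to $\Bbbk$) form a group under convolution. For a functional $\varphi$, $\bar\varphi(h)=(-1)^n\varphi(h)$ on homogeneous $h$ of degree $n$; $\varphi$ is even if $\bar\varphi=\varphi$ and odd if $\bar\varphi=\varphi^{-1}$. Every character factors uniquely as $\varphi=\varphi_+\varphi_-$ with $\varphi_+$ even and $\varphi_-$ odd characters. $\zeta(f)=f(1,0,0,\ldots)$ is the universal character ($\zeta(F_\alpha)=1$ if $\alpha=()$ or $\alpha=(n)$, else $0$), $\zeta^{-1}$ its convolution inverse, and $(\zeta^{-1})_\pm$ the even and odd parts of $\zeta^{-1}$. $C(p,q)=\frac{(2p)!(2q)!}{p!(p+q)!q!}$. *)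

theory Defs
  imports Main
begin

text \<open>Compositions are lists of positive naturals.  A linear functional on QSym is
represented by its values on the monomial basis: phi alpha = phi(M_alpha); it is
required to vanish on lists that are not compositions.\<close>

definition is_comp :: "nat list \<Rightarrow> bool" where
  "is_comp a \<longleftrightarrow> (\<forall>x\<in>set a. 0 < x)"

definition descents :: "nat list \<Rightarrow> nat set" where
  "descents a = {sum_list (take i a) | i. 0 < i \<and> i < length a}"

definition refines :: "nat list \<Rightarrow> nat list \<Rightarrow> bool" where
  "refines b a \<longleftrightarrow> is_comp b \<and> sum_list b = sum_list a \<and> descents a \<subseteq> descents b"

definition conjugate :: "nat list \<Rightarrow> nat list" where
  "conjugate a = (THE b. is_comp b \<and> sum_list b = sum_list a \<and>
     descents b = {1..<sum_list a} - {sum_list a - d | d. d \<in> descents a})"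

definition p_minus :: "nat list \<Rightarrow> nat" where
  "p_minus a = card {i. i < length a - 1 \<and> a ! i > 1}"

definition p_plus :: "nat list \<Rightarrow> nat" where
  "p_plus a = (if 1 < length a
     then 1 + card {i. 0 < i \<and> i < length a - 1 \<and> a ! i > 1} else 0)"

text \<open>C(p,q) = (2p)!(2q)!/(p!(p+q)!q!), an integer.\<close>
definition superC :: "nat \<Rightarrow> nat \<Rightarrow> nat" where
  "superC p q = fact (2*p) * fact (2*q) div (fact p * fact (p+q) * fact q)"

text \<open>Quasi-shuffles (with multiplicity): M_a * M_b = sum over qsh a b of M_c.\<close>
fun qsh :: "nat list \<Rightarrow> nat list \<Rightarrow> nat list list" where
  "qsh [] b = [b]"
| "qsh a [] = [a]"
| "qsh (x#a) (y#b) = map ((#) x) (qsh a (y#b)) @ map ((#) y) (qsh (x#a) b)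
     @ map ((#) (x+y)) (qsh a b)"

definition functional :: "(nat list \<Rightarrow> 'a::field) \<Rightarrow> bool" where
  "functional phi \<longleftrightarrow> (\<forall>a. \<not> is_comp a \<longrightarrow> phi a = 0)"

definition onF :: "(nat list \<Rightarrow> 'a::field) \<Rightarrow> nat list \<Rightarrow> 'a" where
  "onF phi a = (\<Sum>b\<in>{b. refines b a}. phi b)"

text \<open>Convolution, via Delta(M_a) = sum_i M_(a1..ai) \<otimes> M_(a(i+1)..ak).\<close>
definition conv :: "(nat list \<Rightarrow> 'a::field) \<Rightarrow> (nat list \<Rightarrow> 'a) \<Rightarrow> nat list \<Rightarrow> 'a" where
  "conv r s a = (if is_comp a then (\<Sum>i\<le>length a. r (take i a) * s (drop i a)) else 0)"

definition eps :: "nat list \<Rightarrow> 'a::field" where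
  "eps a = (if a = [] then 1 else 0)"

definition bar :: "(nat list \<Rightarrow> 'a::field) \<Rightarrow> nat list \<Rightarrow> 'a" where
  "bar phi a = (-1) ^ sum_list a * phi a"

definition conv_inverse_pair :: "(nat list \<Rightarrow> 'a::field) \<Rightarrow> (nat list \<Rightarrow> 'a) \<Rightarrow> bool" where
  "conv_inverse_pair r s \<longleftrightarrow> conv r s = eps \<and> conv s r = eps"

definition character :: "(nat list \<Rightarrow> 'a::field) \<Rightarrow> bool" where
  "character phi \<longleftrightarrow> functional phi \<and> phi [] = 1 \<and>
     (\<forall>a b. is_comp a \<longrightarrow> is_comp b \<longrightarrow> sum_list (map phi (qsh a b)) = phi a * phi b)"

definition even_fun :: "(nat list \<Rightarrow> 'a::field) \<Rightarrow> bool" where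
  "even_fun phi \<longleftrightarrow> bar phi = phi"

definition odd_fun :: "(nat list \<Rightarrow> 'a::field) \<Rightarrow> bool" where
  "odd_fun phi \<longleftrightarrow> conv_inverse_pair (bar phi) phi"

text \<open>Universal character zeta(f) = f(1,0,0,...): zeta(M_a) = 1 iff length a \<le> 1.\<close>
definition zeta :: "nat list \<Rightarrow> 'a::field" where
  "zeta a = (if is_comp a \<and> length a \<le> 1 then 1 else 0)"

definition conv_inv :: "(nat list \<Rightarrow> 'a::field) \<Rightarrow> nat list \<Rightarrow> 'a" where
  "conv_inv phi = (THE s. functional s \<and> conv_inverse_pair phi s)"

definition even_odd_parts :: "(nat list \<Rightarrow> 'a::field) \<Rightarrow> (nat list \<Rightarrow> 'a) \<times> (nat list \<Rightarrow> 'a)" where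
  "even_odd_parts phi = (THE (p, m). character p \<and> character m \<and> even_fun p \<and> odd_fun m
      \<and> conv p m = phi)"

definition even_part :: "(nat list \<Rightarrow> 'a::field) \<Rightarrow> nat list \<Rightarrow> 'a" where
  "even_part phi = fst (even_odd_parts phi)"

definition odd_part :: "(nat list \<Rightarrow> 'a::field) \<Rightarrow> nat list \<Rightarrow> 'a" where
  "odd_part phi = snd (even_odd_parts phi)"

end

theory Submission
  imports Defs "HOL-Computational_Algebra.Formal_Power_Series"
begin

text \<open>
  Let \<open>e\<close> and \<open>o\<close> count the even and the odd parts of a composition. For a power series \<open>f\<close> let
  \<open>P f\<close> be the functional taking the value \<open>(-1)^e * f $ o\<close> on \<open>M\<close>, and let \<open>Q f\<close> be its restriction
  to the compositions that are empty or start with an odd part. Cutting a composition just before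
  one of its odd parts shows \<open>Q f * Q g = Q (f g)\<close> and \<open>P f * Q g = P (f g)\<close>. Since the inverse of
  \<open>zeta\<close> is \<open>P (1 / (1 + X))\<close>, its even and odd parts are \<open>P S\<close> and \<open>Q (S (1 - X))\<close>, where \<open>S\<close> is the
  inverse square root of \<open>1 - X\<^sup>2\<close>. The second is a character because its square is
  \<open>bar zeta * zeta_inv\<close> and square roots are unique in characteristic different from 2; then so is
  the first.

  Summing over the refinements of a composition of \<open>n\<close> with \<open>q\<close> parts greater than 1, where odd parts
  get the weight \<open>s\<close> and even parts the weight \<open>-1\<close>, gives \<open>s^(n - 2q) (s\<^sup>2 - 1)^q\<close>. So the values on
  \<open>F\<close> are iterated step-two differences of central binomial coefficients over powers of 4, and
  the recurrence \<open>4 C(p,q) = C(p+1,q) + C(p,q+1)\<close> turns them into super Catalan numbers.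
\<close>

section \<open>Descents and refinement\<close>

lemma descents_Nil [simp]: "descents [] = {}"
  by (auto simp: descents_def)

lemma descents_Cons:
  "descents (x # a) = (if a = [] then {} else insert x ((+) x ` descents a))"
proof (cases "a = []")
  case True
  then show ?thesis by (auto simp: descents_def)
next
  case False
  have "descents (x # a) = insert x ((+) x ` descents a)"
  proof (intro equalityI subsetI)
    fix d assume "d \<in> descents (x # a)"
    then obtain i where i: "0 < i" "i < length (x # a)" "d = sum_list (take i (x # a))"
      by (auto simp: descents_def)
    then obtain j where j: "i = Suc j" by (cases i) auto
    show "d \<in> insert x ((+) x ` descents a)"
    proof (cases "j = 0")
      case False
      then have "sum_list (take j a) \<in> descents a"
        using i j by (auto simp: descents_def)
      then show ?thesis using i j by auto
    qed (use i j in auto)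
  next
    fix d assume "d \<in> insert x ((+) x ` descents a)"
    then consider "d = x" | j where "0 < j" "j < length a" "d = x + sum_list (take j a)"
      by (auto simp: descents_def)
    then show "d \<in> descents (x # a)"
    proof cases
      case 1
      then show ?thesis using False by (auto simp: descents_def intro!: exI[of _ 1])
    next
      case 2
      then show ?thesis by (auto simp: descents_def intro!: exI[of _ "Suc j"])
    qed
  qed
  with False show ?thesis by simp
qed

lemma is_comp_Nil [simp]: "is_comp []"
  and is_comp_Cons [simp]: "is_comp (x # a) \<longleftrightarrow> 0 < x \<and> is_comp a"
  by (auto simp: is_comp_def)

lemma is_comp_sum_list_0: "is_comp b \<Longrightarrow> sum_list b = 0 \<longleftrightarrow> b = []"
  by (cases b) auto

lemma is_comp_sum_list_pos: "is_comp b \<Longrightarrow> b \<noteq> [] \<Longrightarrow> 0 < sum_list b"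
  by (cases b) auto

lemma descents_bounds: "is_comp a \<Longrightarrow> descents a \<subseteq> {1..<sum_list a}"
proof (induction a)
  case (Cons x a)
  have "is_comp a" using Cons.prems by simp
  from is_comp_sum_list_pos[OF this] Cons.IH[OF this] Cons.prems show ?case
    by (auto simp: descents_Cons simp del: sum_list_eq_0_iff not_gr_zero)
qed simp

lemma descents_Suc_Cons: "descents (Suc x # a) = Suc ` descents (x # a)"
  by (auto simp: descents_Cons image_image)

lemma descents_1_Cons: "a \<noteq> [] \<Longrightarrow> descents (Suc 0 # a) = insert (Suc 0) (Suc ` descents a)"
  by (auto simp: descents_Cons)

lemma refines_Nil: "{b. refines b []} = {[]}"
  using is_comp_sum_list_0 by (auto simp: refines_def simp del: sum_list_eq_0_iff)

text \<open>A first part 1 cannot be subdivided, and for nonempty \<open>a\<close> the descent 1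
  forces every refinement to start with 1.\<close>

lemma refines_1_Cons:
  assumes "is_comp a"
  shows "{b. refines b (Suc 0 # a)} = (#) (Suc 0) ` {b. refines b a}"
proof (intro equalityI subsetI)
  fix c assume "c \<in> {b. refines b (Suc 0 # a)}"
  then have c: "is_comp c" "sum_list c = Suc (sum_list a)"
    "descents (Suc 0 # a) \<subseteq> descents c" by (auto simp: refines_def)
  then obtain y b where yb: "c = y # b" by (cases c) auto
  have y: "y = Suc 0"
  proof (rule ccontr)
    assume "y \<noteq> Suc 0"
    then obtain z where z: "y = Suc z" "z > 0" using c yb by (cases y) auto
    have "a \<noteq> []"
      using c yb z by auto
    then have "Suc 0 \<in> descents c" using c by (auto simp: descents_1_Cons)
    \<comment> \<open>Lowering the first part by 1 shifts all descents down, so the descent 1 would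
      become the impossible descent 0.\<close>
    then have "0 \<in> descents (z # b)" using yb z by (auto simp: descents_Suc_Cons)
    then show False using descents_bounds[of "z # b"] c yb z by auto
  qed
  have "descents a \<subseteq> descents b"
  proof (cases "a = []")
    case False
    then have "b \<noteq> []" using c yb y is_comp_sum_list_0[OF assms] by auto
    then have *: "insert (Suc 0) (Suc ` descents a) \<subseteq> insert (Suc 0) (Suc ` descents b)"
      using c yb y False by (simp add: descents_1_Cons)
    have "0 \<notin> descents a"
      using descents_bounds[OF assms] by auto
    with * show ?thesis by (auto 0 4)
  qed auto
  then show "c \<in> (#) (Suc 0) ` {b. refines b a}"
    using c yb y by (auto simp: refines_def)
next
  fix c assume "c \<in> (#) (Suc 0) ` {b. refines b a}"
  then obtain b where b: "c = Suc 0 # b" "is_comp b" "sum_list b = sum_list a"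
    "descents a \<subseteq> descents b" by (auto simp: refines_def)
  have "a = [] \<longleftrightarrow> b = []"
    using b assms is_comp_sum_list_0 by metis
  then show "c \<in> {b. refines b (Suc 0 # a)}"
    using b by (cases "a = []") (auto simp: refines_def descents_1_Cons descents_Cons)
qed

definition inc_hd :: "nat list \<Rightarrow> nat list" where
  "inc_hd b = Suc (hd b) # tl b"

text \<open>The extra unit either forms a part of its own or is absorbed into the first part of a
  refinement of \<open>x # a\<close>. Both are allowed, since 1 is not a descent of
  \<open>Suc x # a\<close>.\<close>

lemma refines_Suc_Cons:
  assumes "is_comp a" "0 < x"
  shows "{b. refines b (Suc x # a)} =
     (#) (Suc 0) ` {b. refines b (x # a)} \<union> inc_hd ` {b. refines b (x # a)}"
proof (intro equalityI subsetI)
  fix c assume "c \<in> {b. refines b (Suc x # a)}"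
  then have c: "is_comp c" "sum_list c = Suc (x + sum_list a)"
    "Suc ` descents (x # a) \<subseteq> descents c" by (auto simp: refines_def descents_Suc_Cons)
  then obtain z b where zb: "c = Suc z # b"
    by (cases c) (auto simp: gr0_conv_Suc)
  show "c \<in> (#) (Suc 0) ` {b. refines b (x # a)} \<union> inc_hd ` {b. refines b (x # a)}"
  proof (cases "z = 0")
    case True
    then have "b \<noteq> []" using c zb assms by auto
    then have "descents (x # a) \<subseteq> descents b"
      using c zb True descents_bounds[of "x # a"] assms by (fastforce simp: descents_1_Cons)
    then show ?thesis using True c zb by (auto simp: refines_def)
  next
    case False
    then have "refines (z # b) (x # a)"
      using c zb by (auto simp: refines_def descents_Suc_Cons)
    then have "inc_hd (z # b) \<in> inc_hd ` {b. refines b (x # a)}" by blast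
    then show ?thesis using zb by (simp add: inc_hd_def)
  qed
next
  fix c assume "c \<in> (#) (Suc 0) ` {b. refines b (x # a)} \<union> inc_hd ` {b. refines b (x # a)}"
  then obtain b where b: "refines b (x # a)" "c = Suc 0 # b \<or> c = inc_hd b" by blast
  then have "b \<noteq> []" using assms by (auto simp: refines_def)
  then obtain y b' where "b = y # b'" by (cases b) auto
  moreover have "descents (Suc 0 # b) = insert (Suc 0) (Suc ` descents b)"
    using \<open>b \<noteq> []\<close> by (rule descents_1_Cons)
  ultimately show "c \<in> {b. refines b (Suc x # a)}"
    using b descents_Suc_Cons[of x a] descents_Suc_Cons[of y b']
    by (auto simp: refines_def inc_hd_def)
qed

lemma refines_imp_comp: "refines b a \<Longrightarrow> is_comp b"
  by (simp add: refines_def)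

lemma refines_Cons_imp:
  assumes "0 < x" "refines b (x # a)"
  obtains y b' where "b = y # b'" "0 < y"
  using assms by (cases b) (auto simp: refines_def)

lemma finite_refines: "is_comp a \<Longrightarrow> finite {b. refines b a}"
proof (induction a)
  case Nil
  then show ?case by (simp add: refines_Nil)
next
  case (Cons x a)
  then have a: "is_comp a" "finite {b. refines b a}" by auto
  have "finite {b. refines b (x # a)}" if "0 < x" for x
    using that
  proof (induction x rule: nat_induct_non_zero)
    case 1
    then show ?case using a by (simp add: refines_1_Cons)
  next
    case (Suc n)
    then show ?case using a by (simp add: refines_Suc_Cons)
  qed
  then show ?case using Cons by simp
qed

section \<open>Sums over refinements of parity weights\<close>

definition evens :: "nat list \<Rightarrow> nat" where
  "evens b = length (filter even b)"

definition odds :: "nat list \<Rightarrow> nat" where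
  "odds b = length (filter odd b)"

text \<open>An arbitrary function takes the place of a coefficient sequence because the recursions
  over refinements shift its argument.\<close>

definition parity_wt :: "(nat \<Rightarrow> 'a::field) \<Rightarrow> nat list \<Rightarrow> 'a" where
  "parity_wt f b = (-1) ^ evens b * f (odds b)"

lemma parity_wt_Cons:
  "parity_wt f (x # b) = (if even x then - parity_wt f b else parity_wt (\<lambda>k. f (Suc k)) b)"
  by (simp add: parity_wt_def evens_def odds_def)

text \<open>The first part is left out of the weight here: splitting by its parity makes the recursion
  over refinements close up.\<close>
definition odd_hd_sum :: "(nat \<Rightarrow> 'a::field) \<Rightarrow> nat list \<Rightarrow> 'a" where
  "odd_hd_sum f a = (\<Sum>b | refines b a. if odd (hd b) then parity_wt f (tl b) else 0)"

definition even_hd_sum :: "(nat \<Rightarrow> 'a::field) \<Rightarrow> nat list \<Rightarrow> 'a" where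
  "even_hd_sum f a = (\<Sum>b | refines b a. if even (hd b) then parity_wt f (tl b) else 0)"

lemma onF_parity_wt_Cons:
  assumes "0 < x"
  shows "onF (parity_wt f) (x # a) =
    odd_hd_sum (\<lambda>k. f (Suc k)) (x # a) - even_hd_sum f (x # a)"
  unfolding onF_def odd_hd_sum_def even_hd_sum_def sum_subtractf[symmetric]
proof (rule sum.cong)
  fix b assume "b \<in> {b. refines b (x # a)}"
  with assms obtain y b' where "b = y # b'" by (auto elim: refines_Cons_imp)
  then show "parity_wt f b =
    (if odd (hd b) then parity_wt (\<lambda>k. f (Suc k)) (tl b) else 0) -
    (if even (hd b) then parity_wt f (tl b) else 0)"
    by (simp add: parity_wt_Cons)
qed simp

lemma hd_sums_1:
  assumes "is_comp a"
  shows "odd_hd_sum f (Suc 0 # a) = onF (parity_wt f) a"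
    and "even_hd_sum f (Suc 0 # a) = 0"
  by (simp_all add: odd_hd_sum_def even_hd_sum_def onF_def refines_1_Cons[OF assms]
      sum.reindex o_def)

lemma sum_refines_Suc:
  fixes g :: "nat list \<Rightarrow> 'a::field"
  assumes "is_comp a" "0 < x"
  shows "(\<Sum>b | refines b (Suc x # a). g b) =
    (\<Sum>b | refines b (x # a). g (Suc 0 # b)) + (\<Sum>b | refines b (x # a). g (inc_hd b))"
proof -
  have ne: "b \<noteq> [] \<and> 0 < hd b" if "refines b (x # a)" for b
    using refines_Cons_imp[OF assms(2) that] by force
  have inj: "inj_on inc_hd {b. refines b (x # a)}"
    by (rule inj_onI) (use ne in \<open>auto simp: inc_hd_def intro: list.expand\<close>)
  have "(\<Sum>b | refines b (Suc x # a). g b) =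
    (\<Sum>b\<in>(#) (Suc 0) ` {b. refines b (x # a)}. g b) + (\<Sum>b\<in>inc_hd ` {b. refines b (x # a)}. g b)"
    unfolding refines_Suc_Cons[OF assms]
    by (rule sum.union_disjoint)
       (use assms finite_refines[of "x # a"] in \<open>auto simp: inc_hd_def dest: ne\<close>)
  also have "\<dots> = (\<Sum>b | refines b (x # a). g (Suc 0 # b)) + (\<Sum>b | refines b (x # a). g (inc_hd b))"
    using inj by (simp add: sum.reindex)
  finally show ?thesis .
qed

text \<open>A new part 1 in front contributes all of \<open>onF (parity_wt f) (x # a)\<close> to the
  odd sum, while lengthening the first part swaps the parities. In the odd sum the term
  \<open>even_hd_sum f (x # a)\<close> then cancels.\<close>

lemma hd_sums_Suc:
  assumes "is_comp a" "0 < x"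
  shows "odd_hd_sum f (Suc x # a) = odd_hd_sum (\<lambda>k. f (Suc k)) (x # a)"
    and "even_hd_sum f (Suc x # a) = odd_hd_sum f (x # a)"
proof -
  have "odd_hd_sum f (Suc x # a) = onF (parity_wt f) (x # a) + even_hd_sum f (x # a)"
    unfolding odd_hd_sum_def sum_refines_Suc[OF assms] even_hd_sum_def onF_def
    by (simp add: inc_hd_def cong: if_cong)
  then show "odd_hd_sum f (Suc x # a) = odd_hd_sum (\<lambda>k. f (Suc k)) (x # a)"
    using assms by (simp add: onF_parity_wt_Cons)
  show "even_hd_sum f (Suc x # a) = odd_hd_sum f (x # a)"
    unfolding odd_hd_sum_def sum_refines_Suc[OF assms] even_hd_sum_def
    by (simp add: inc_hd_def cong: if_cong)
qed

lemma odd_hd_sum_Cons: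
  assumes "is_comp a"
  shows "odd_hd_sum f (Suc x # a) = onF (parity_wt (\<lambda>k. f (k + x))) a"
proof (induction x arbitrary: f)
  case 0
  then show ?case using assms by (simp add: hd_sums_1)
next
  case (Suc x)
  then show ?case using assms by (simp add: hd_sums_Suc(1)[of a "Suc x"])
qed

text \<open>Refinements with odd first part account for the shift by \<open>x\<close>, those with
  even first part for the shift by \<open>x - 2\<close>. In terms of weights this is the factor
  \<open>s^x - s^(x-2) = s^(x-2) (s^2 - 1)\<close> of a part greater than 1.\<close>

lemma onF_parity_wt_rec:
  assumes "is_comp a" "0 < x"
  shows "onF (parity_wt f) (x # a) = onF (parity_wt (\<lambda>k. f (k + x))) a -
     (if 1 < x then onF (parity_wt (\<lambda>k. f (k + (x - 2)))) a else 0)"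
proof -
  obtain z where z: "x = Suc z" using assms by (cases x) auto
  show ?thesis
  proof (cases z)
    case 0
    then show ?thesis
      using assms z by (simp add: onF_parity_wt_Cons hd_sums_1)
  next
    case (Suc y)
    then show ?thesis
      using assms z
      by (simp add: onF_parity_wt_Cons odd_hd_sum_Cons hd_sums_Suc(2)[of a "Suc y"])
  qed
qed

definition long_parts :: "nat list \<Rightarrow> nat" where
  "long_parts a = length (filter (\<lambda>x. 1 < x) a)"

definition diff2 :: "(nat \<Rightarrow> 'a::field) \<Rightarrow> nat \<Rightarrow> 'a" where
  "diff2 f k = f (k + 2) - f k"

lemma long_parts_bound: "2 * long_parts a \<le> sum_list a"
  by (induction a) (auto simp: long_parts_def)

text \<open>A part \<open>x > 1\<close> contributes one difference and a shift by
  \<open>x - 2\<close>, a part 1 only a shift by 1. The offset \<open>j\<close> is there for the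
  induction, as the recursion shifts the argument of \<open>f\<close>.\<close>

lemma onF_parity_wt:
  assumes "is_comp a"
  shows "onF (parity_wt (\<lambda>k. f (k + j))) a =
     (diff2 ^^ long_parts a) f (sum_list a - 2 * long_parts a + j)"
  using assms
proof (induction a arbitrary: j)
  case Nil
  then show ?case by (simp add: onF_def refines_Nil parity_wt_def long_parts_def evens_def odds_def)
next
  case (Cons x a)
  have b: "2 * long_parts a \<le> sum_list a" by (rule long_parts_bound)
  have IH: "onF (parity_wt (\<lambda>k. f (k + i + j))) a =
     (diff2 ^^ long_parts a) f (sum_list a - 2 * long_parts a + (i + j))" for i
    using Cons.IH[of "i + j"] Cons.prems by (simp add: add.assoc)
  show ?case
  proof (cases "1 < x")
    case True
    then obtain z where z: "x = z + 2"
      by (metis add.commute less_iff_Suc_add add_2_eq_Suc' One_nat_def plus_1_eq_Suc)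
    have L: "long_parts (x # a) = Suc (long_parts a)"
      using True by (simp add: long_parts_def)
    have "sum_list (x # a) - 2 * long_parts (x # a) + j = sum_list a - 2 * long_parts a + (z + j)"
      using b z L by simp
    moreover have "sum_list a - 2 * long_parts a + (z + j) + 2 =
      sum_list a - 2 * long_parts a + (x + j)" using z by simp
    ultimately have "(diff2 ^^ long_parts (x # a)) f (sum_list (x # a) - 2 * long_parts (x # a) + j) =
       onF (parity_wt (\<lambda>k. f (k + x + j))) a - onF (parity_wt (\<lambda>k. f (k + z + j))) a"
      unfolding L IH funpow.simps o_apply diff2_def[of "(diff2 ^^ _) f"] by (simp add: z add.assoc)
    then show ?thesis
      using True z Cons.prems onF_parity_wt_rec[of a x "\<lambda>k. f (k + j)"] by simp
  next
    case False
    then have x: "x = 1" using Cons.prems by auto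
    then show ?thesis
      using Cons.prems b IH[of 1] onF_parity_wt_rec[of a x "\<lambda>k. f (k + j)"]
      by (simp add: long_parts_def Suc_diff_le)
  qed
qed

section \<open>Super Catalan numbers\<close>

lemma fact_Suc_double: "(fact (2 * Suc p) :: 'b::{semiring_char_0}) =
    of_nat (2 * Suc p) * of_nat (2 * p + 1) * fact (2 * p)"
proof -
  have "2 * Suc p = Suc (Suc (2 * p))" by simp
  then show ?thesis by (simp only: fact_Suc) (simp add: algebra_simps)
qed

text \<open>Induction on \<open>q\<close> for all \<open>p\<close> at once: the recurrence
  \<open>C(p,q+1) = 4 C(p,q) - C(p+1,q)\<close> expresses the next quotient integrally by earlier
  ones. The subtraction is the reason for working in the integers.\<close>

lemma superC_dvd: "fact p * fact (p + q) * fact q dvd (fact (2 * p) * fact (2 * q) :: int)"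
proof (induction q arbitrary: p)
  case 0
  have "int (fact p * fact (2 * p - p) * (2 * p choose p)) = int (fact (2 * p))"
    by (subst binomial_fact_lemma) auto
  then have "(fact (2 * p) :: int) = fact p * fact p * int (2 * p choose p)"
    by (simp add: of_nat_fact)
  then show ?case by simp
next
  case (Suc q)
  define D :: int where "D = fact p * fact (p + q) * fact q"
  define N :: int where "N = fact (2 * p) * fact (2 * q)"
  obtain u where u: "N = D * u" using Suc[of p] by (auto simp: D_def N_def)
  have D0: "D \<noteq> 0" by (simp add: D_def)
  \<comment> \<open>This is the hypothesis at \<open>Suc p\<close>, written in terms of
    \<open>D\<close> and \<open>N\<close>. Thus \<open>u\<close> is the quotient at
    \<open>(p, q)\<close> and \<open>v\<close> the one at \<open>(p + 1, q)\<close>, and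
    \<open>4 * u - v\<close> will be the one at \<open>(p, q + 1)\<close>.\<close>
  have "D * ((int p + 1) * (int p + int q + 1)) dvd N * ((2 * int p + 2) * (2 * int p + 1))"
  proof -
    have "fact (Suc p) * fact (Suc p + q) * fact q = D * ((int p + 1) * (int p + int q + 1))"
      by (simp add: D_def algebra_simps)
    moreover have "fact (2 * Suc p) * fact (2 * q) = N * ((2 * int p + 2) * (2 * int p + 1))"
      unfolding fact_Suc_double by (simp add: N_def algebra_simps)
    ultimately show ?thesis using Suc[of "Suc p"] by metis
  qed
  then obtain v where "N * ((2 * int p + 2) * (2 * int p + 1)) =
    D * ((int p + 1) * (int p + int q + 1)) * v" by auto
  then have "(D * (int p + 1)) * (u * (2 * (2 * int p + 1))) = (D * (int p + 1)) * ((int p + int q + 1) * v)"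
    using u by (simp add: algebra_simps)
  then have v: "u * (2 * (2 * int p + 1)) = (int p + int q + 1) * v"
    using D0 by (subst (asm) mult_left_cancel) auto
  have "N * ((2 * int q + 2) * (2 * int q + 1)) =
    (D * ((int p + int q + 1) * (int q + 1))) * (4 * u - v)"
  proof -
    have "(D * ((int p + int q + 1) * (int q + 1))) * (4 * u - v) =
      D * (int q + 1) * (4 * u * (int p + int q + 1) - (int p + int q + 1) * v)"
      by (simp add: algebra_simps)
    then show ?thesis unfolding v[symmetric] u by (simp add: algebra_simps)
  qed
  moreover have "fact p * fact (p + Suc q) * fact (Suc q) = D * ((int p + int q + 1) * (int q + 1))"
    by (simp add: D_def algebra_simps)
  moreover have "fact (2 * p) * fact (2 * Suc q) = N * ((2 * int q + 2) * (2 * int q + 1))"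
    unfolding fact_Suc_double by (simp add: N_def algebra_simps)
  ultimately show ?case by (metis dvd_triv_left)
qed

lemma superC_mult: "superC p q * (fact p * fact (p + q) * fact q) = fact (2 * p) * fact (2 * q)"
proof -
  have "int (fact p * fact (p + q) * fact q) dvd int (fact (2 * p) * fact (2 * q))"
    using superC_dvd[of p q] by (simp add: of_nat_fact)
  then show ?thesis
    unfolding superC_def by (intro dvd_div_mult_self) (simp only: int_dvd_int_iff)
qed

lemma superC_commute: "superC p q = superC q p"
  by (simp add: superC_def mult_ac add.commute)

lemma superC_0_0: "superC 0 0 = 1"
  by (simp add: superC_def)

lemma superC_Suc_left: "(p + q + 1) * superC (Suc p) q = 2 * (2 * p + 1) * superC p q"
proof -
  define D :: nat where "D = fact p * fact (p + q) * fact q"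
  have D: "superC p q * D = fact (2 * p) * fact (2 * q)"
    using superC_mult[of p q] by (simp add: D_def)
  have "superC (Suc p) q * (D * ((p + 1) * (p + q + 1))) =
    (fact (2 * p) * fact (2 * q)) * (2 * (p + 1) * (2 * p + 1))"
    using superC_mult[of "Suc p" q] unfolding fact_Suc_double
    by (simp add: D_def algebra_simps)
  then have "(D * (p + 1)) * ((p + q + 1) * superC (Suc p) q) = (D * (p + 1)) * (2 * (2 * p + 1) * superC p q)"
    unfolding D[symmetric] by (simp add: algebra_simps)
  then show ?thesis
    by (subst (asm) mult_left_cancel) (auto simp: D_def)
qed

lemma superC_Suc_right: "(p + q + 1) * superC p (Suc q) = 2 * (2 * q + 1) * superC p q"
  using superC_Suc_left[of q p] by (simp add: superC_commute[of _ p] add.commute)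

text \<open>The two neighbours are \<open>C(p,q)\<close> times \<open>2(2p+1)/(p+q+1)\<close> and
  \<open>2(2q+1)/(p+q+1)\<close>, and these factors add up to 4.\<close>

lemma superC_rec: "superC (Suc p) q + superC p (Suc q) = 4 * superC p q"
proof -
  have "(p + q + 1) * (superC (Suc p) q + superC p (Suc q)) = (p + q + 1) * (4 * superC p q)"
    unfolding distrib_left superC_Suc_left superC_Suc_right by (simp add: algebra_simps)
  then show ?thesis by (subst (asm) mult_left_cancel) auto
qed

text \<open>\<open>superC 0 i\<close> is the central binomial coefficient. Its first-order
  recurrence involves the factor \<open>i\<close>, so the convolution is first weighted by the
  index; symmetry then removes the weight.\<close>

lemma superC_convolution: "(\<Sum>i\<le>n. superC 0 i * superC 0 (n - i)) = 4 ^ n"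
proof (induction n)
  case 0
  then show ?case by (simp add: superC_0_0)
next
  case (Suc n)
  let ?c = "superC 0"
  \<comment> \<open>The product is invariant under exchanging \<open>i\<close> and
    \<open>m - i\<close>, so the weight \<open>i\<close> averages to \<open>m / 2\<close>.\<close>
  have sym: "2 * (\<Sum>i\<le>m. i * (?c i * ?c (m - i))) = m * (\<Sum>i\<le>m. ?c i * ?c (m - i))" for m
  proof -
    have "(\<Sum>i\<le>m. i * (?c i * ?c (m - i))) = (\<Sum>i\<le>m. (m - i) * (?c i * ?c (m - i)))"
      by (rule sum.reindex_bij_witness[of _ "\<lambda>i. m - i" "\<lambda>i. m - i"]) auto
    then have "2 * (\<Sum>i\<le>m. i * (?c i * ?c (m - i))) =
      (\<Sum>i\<le>m. i * (?c i * ?c (m - i)) + (m - i) * (?c i * ?c (m - i)))"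
      by (simp add: sum.distrib)
    also have "\<dots> = (\<Sum>i\<le>m. m * (?c i * ?c (m - i)))"
      by (rule sum.cong) (auto simp flip: distrib_right)
    finally show ?thesis by (simp add: sum_distrib_left)
  qed
  have "Suc n * (\<Sum>i\<le>Suc n. ?c i * ?c (Suc n - i)) = 2 * (\<Sum>i\<le>Suc n. i * (?c i * ?c (Suc n - i)))"
    by (rule sym[symmetric])
  also have "(\<Sum>i\<le>Suc n. i * (?c i * ?c (Suc n - i))) = (\<Sum>i\<le>n. Suc i * (?c (Suc i) * ?c (n - i)))"
    by (subst sum.atMost_Suc_shift) simp
  also have "\<dots> = (\<Sum>i\<le>n. 4 * (i * (?c i * ?c (n - i))) + 2 * (?c i * ?c (n - i)))"
  proof (rule sum.cong)
    fix i
    have "Suc i * ?c (Suc i) = 2 * (2 * i + 1) * ?c i" using superC_Suc_right[of 0 i] by simp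
    then have "Suc i * (?c (Suc i) * ?c (n - i)) = 2 * (2 * i + 1) * ?c i * ?c (n - i)"
      by (metis mult.assoc)
    then show "Suc i * (?c (Suc i) * ?c (n - i)) =
        4 * (i * (?c i * ?c (n - i))) + 2 * (?c i * ?c (n - i))" by (simp add: algebra_simps)
  qed simp
  also have "\<dots> = 2 * (2 * (\<Sum>i\<le>n. i * (?c i * ?c (n - i)))) + 2 * (\<Sum>i\<le>n. ?c i * ?c (n - i))"
    by (simp add: sum.distrib sum_distrib_left mult.assoc)
  also have "2 * \<dots> = Suc n * (4 * 4 ^ n)"
    unfolding sym Suc.IH by (simp add: algebra_simps)
  finally show ?case by (subst (asm) mult_left_cancel) auto
qed

text \<open>By \<open>superC_rec\<close>, each difference raises the first argument of
  \<open>superC\<close> by one, at the price of a sign and a factor 4 in the denominator. In the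
  applications \<open>s\<close> is the parity of \<open>n\<close>, and \<open>e\<close> is a sign or
  the indicator of even \<open>n\<close>.\<close>

lemma diff2_funpow_superC:
  fixes f :: "nat \<Rightarrow> 'a::field"
  assumes "(2::'a) \<noteq> 0"
    and f: "\<And>r. f (2 * r + s) = e * of_nat (superC 0 r) / 4 ^ r"
  shows "(diff2 ^^ q) f (2 * r + s) = e * (-1) ^ q * of_nat (superC q r) / 4 ^ (q + r)"
proof (induction q arbitrary: r)
  case 0
  then show ?case by (simp add: f)
next
  case (Suc q)
  have "(4::'a) = 2 * 2" by simp
  with assms(1) have 4: "(4::'a) \<noteq> 0" by (metis mult_eq_0_iff)
  have rec: "(of_nat (superC (Suc q) r) :: 'a) = 4 * of_nat (superC q r) - of_nat (superC q (Suc r))"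
    using arg_cong[OF superC_rec[of q r], of "of_nat :: nat \<Rightarrow> 'a"] by (simp add: algebra_simps)
  have "2 * r + s + 2 = 2 * Suc r + s" by simp
  then have "(diff2 ^^ Suc q) f (2 * r + s) =
      (diff2 ^^ q) f (2 * Suc r + s) - (diff2 ^^ q) f (2 * r + s)"
    unfolding funpow.simps o_apply diff2_def[of "(diff2 ^^ _) f"] by (simp only:)
  then show ?case
    unfolding Suc.IH rec using 4 by (simp add: field_simps)
qed

section \<open>Conjugate compositions\<close>

text \<open>The first part is the least descent, or the whole sum if there is none; the other
  descents, shifted, determine the tail.\<close>

lemma descents_inj:
  assumes "is_comp b" "is_comp c" "sum_list b = sum_list c" "descents b = descents c"
  shows "b = c"
  using assms
proof (induction b arbitrary: c)
  case Nil
  then show ?case using is_comp_sum_list_0[of c] by auto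
next
  case (Cons x b)
  then obtain y c' where c: "c = y # c'" by (cases c) auto
  have bb: "descents b \<subseteq> {1..<sum_list b}" "descents c' \<subseteq> {1..<sum_list c'}"
    using Cons.prems c descents_bounds by auto
  have e: "b = [] \<longleftrightarrow> c' = []"
    using Cons.prems c by (auto simp: descents_Cons split: if_splits)
  have xy: "x = y"
  proof (cases "b = []")
    case True
    then show ?thesis using e Cons.prems c by simp
  next
    case False
    then have "insert x ((+) x ` descents b) = insert y ((+) y ` descents c')"
      using e Cons.prems c by (simp add: descents_Cons)
    then have "x \<in> insert y ((+) y ` descents c')" "y \<in> insert x ((+) x ` descents b)" by blast+
    then show ?thesis by auto
  qed
  have "descents b = descents c'"
  proof (cases "b = []")
    case False
    then have *: "insert x ((+) x ` descents b) = insert x ((+) x ` descents c')"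
      using e xy Cons.prems c by (simp add: descents_Cons)
    have "x \<notin> (+) x ` descents b" "x \<notin> (+) x ` descents c'" using bb by auto
    with * have "(+) x ` descents b = (+) x ` descents c'" by (metis insert_ident)
    then show ?thesis by (simp add: inj_image_eq_iff)
  qed (use e in simp)
  then show ?case using Cons.IH[of c'] Cons.prems c xy by simp
qed

text \<open>Induction on \<open>n\<close>: remove the first unit and shift \<open>D\<close> down.
  The unit is put back as a part of its own if \<open>1 \<in> D\<close>, and merged into the first
  part otherwise.\<close>

lemma descents_surj:
  assumes "D \<subseteq> {1..<n}"
  shows "\<exists>b. is_comp b \<and> sum_list b = n \<and> descents b = D"
  using assms
proof (induction n arbitrary: D)
  case 0
  then show ?case by (intro exI[of _ "[]"]) auto
next
  case (Suc n)
  show ?case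
  proof (cases "n = 0")
    case True
    then show ?thesis using Suc.prems by (intro exI[of _ "[1]"]) (auto simp: descents_Cons)
  next
    case False
    define E where "E = {d. 0 < d \<and> Suc d \<in> D}"
    have "E \<subseteq> {1..<n}" using Suc.prems by (auto simp: E_def)
    from Suc.IH[OF this] obtain b where b: "is_comp b" "sum_list b = n" "descents b = E" by blast
    then obtain x b' where xb: "b = x # b'" using False by (cases b) auto
    have DE: "(if 1 \<in> D then insert 1 (Suc ` E) else Suc ` E) = D"
    proof -
      have "d \<in> D \<longleftrightarrow> d = 1 \<and> 1 \<in> D \<or> d \<in> Suc ` E" for d
      proof (cases d)
        case (Suc k)
        then show ?thesis by (cases "k = 0") (auto simp: E_def)
      qed (use Suc.prems in auto)
      then show ?thesis by (cases "1 \<in> D") (simp_all only: if_True if_False, blast+)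
    qed
    show ?thesis
    proof (cases "1 \<in> D")
      case True
      have "descents (Suc 0 # b) = D"
        using DE True b xb by (subst descents_1_Cons) auto
      then show ?thesis using b by (intro exI[of _ "Suc 0 # b"]) simp
    next
      case False
      have "descents (Suc x # b') = D"
        using DE False b xb by (subst descents_Suc_Cons) auto
      then show ?thesis using b xb by (intro exI[of _ "Suc x # b'"]) simp
    qed
  qed
qed

lemma is_comp_conjugate: "is_comp (conjugate a)"
    and descents_conjugate: "descents (conjugate a) =
      {1..<sum_list a} - {sum_list a - d | d. d \<in> descents a}"
proof -
  have "\<exists>!b. is_comp b \<and> sum_list b = sum_list a \<and>
      descents b = {1..<sum_list a} - {sum_list a - d | d. d \<in> descents a}"
  proof (rule ex_ex1I)
    show "\<exists>b. is_comp b \<and> sum_list b = sum_list a \<and>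
      descents b = {1..<sum_list a} - {sum_list a - d | d. d \<in> descents a}"
      by (rule descents_surj) (rule Diff_subset)
  qed (rule descents_inj, simp_all)
  from theI'[OF this, folded conjugate_def]
  show "is_comp (conjugate a)"
    "descents (conjugate a) = {1..<sum_list a} - {sum_list a - d | d. d \<in> descents a}" by blast+
qed

section \<open>Long parts and the statistics of compositions, counted through descents\<close>

lemma card_index_shift:
  fixes P :: "nat \<Rightarrow> bool"
  shows "card {i. i < Suc n \<and> P i} = (if P 0 then 1 else 0) + card {i. i < n \<and> P (Suc i)}"
proof -
  have "{i. i < Suc n \<and> P i} = (if P 0 then {0} else {}) \<union> Suc ` {i. i < n \<and> P (Suc i)}"
    by (auto simp: image_iff less_Suc_eq_0_disj)
  then show ?thesis by (auto simp: card_insert_if card_image)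
qed

lemma p_minus_Cons_Cons: "p_minus (x # y # b) = (if 1 < x then 1 else 0) + p_minus (y # b)"
  using card_index_shift[of "length b" "\<lambda>i. 1 < (x # y # b) ! i"] by (simp add: p_minus_def)

lemma p_plus_Cons: "p_plus (x # b) = (if b = [] then 0 else 1 + p_minus b)"
proof (cases b)
  case (Cons y b')
  have "{i. 0 < i \<and> i < Suc (length b') \<and> 1 < (x # b) ! i} =
      Suc ` {i. i < length b' \<and> 1 < b ! i}"
    by (auto simp: image_iff gr0_conv_Suc)
  then show ?thesis using Cons by (simp add: p_plus_def p_minus_def card_image)
qed (simp add: p_plus_def)

text \<open>For use with reversals, where the part ignored by \<open>p_minus\<close> is the first
  part of the original composition.\<close>

lemma p_minus_snoc: "p_minus (a @ [x]) = long_parts a"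
proof -
  have "{i. i < length a \<and> 1 < (a @ [x]) ! i} = {i. i < length a \<and> 1 < a ! i}"
    by (auto simp: nth_append)
  then show ?thesis by (simp add: p_minus_def long_parts_def length_filter_conv_card)
qed

text \<open>A part greater than 1, other than the last, ends at a descent whose predecessor is not a
  descent. The condition \<open>d \<noteq> 1\<close> excludes a first part 1, as 0 is never a
  descent.\<close>

lemma p_minus_eq_card_descents:
  assumes "is_comp b"
  shows "p_minus b = card {d \<in> descents b. d \<noteq> 1 \<and> d - 1 \<notin> descents b}"
  using assms
proof (induction b)
  case Nil
  then show ?case by (simp add: p_minus_def)
next
  case (Cons x b)
  show ?case
  proof (cases b)
    case Nil
    then show ?thesis by (simp add: p_minus_def descents_Cons)
  next
    case (Cons y b')
    let ?S = "{d \<in> descents b. d \<noteq> 1 \<and> d - 1 \<notin> descents b}"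
    have D: "descents (x # b) = insert x ((+) x ` descents b)" and b: "b \<noteq> []"
      using Cons by (auto simp: descents_Cons)
    have pos: "0 < d" if "d \<in> descents b" for d
      using descents_bounds[of b] Cons.prems that by auto
    have fin: "finite ?S"
      using descents_bounds[of b] Cons.prems by (auto intro: finite_subset)
    have "{d \<in> descents (x # b). d \<noteq> 1 \<and> d - 1 \<notin> descents (x # b)} =
      (if 1 < x then {x} else {}) \<union> (+) x ` ?S"
    proof (rule set_eqI)
      fix d
      have x: "0 < x" using Cons.prems by simp
      show "d \<in> {d \<in> descents (x # b). d \<noteq> 1 \<and> d - 1 \<notin> descents (x # b)} \<longleftrightarrow>
        d \<in> (if 1 < x then {x} else {}) \<union> (+) x ` ?S"
      proof (cases "d \<le> x")
        case True
        then show ?thesis using x pos unfolding D by (auto simp: image_iff dest: pos)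
      next
        case False
        then obtain e where e: "d = x + Suc e" by (metis add_Suc_right less_imp_Suc_add not_le)
        then show ?thesis using x pos unfolding D by (auto simp: image_iff dest: pos)
      qed
    qed
    moreover have "x \<notin> (+) x ` ?S" using pos by auto
    ultimately have "card {d \<in> descents (x # b). d \<noteq> 1 \<and> d - 1 \<notin> descents (x # b)} =
       (if 1 < x then 1 else 0) + card ?S"
      using fin by (simp add: card_insert_if card_image)
    then show ?thesis
      using Cons.IH Cons.prems Cons p_minus_Cons_Cons[of x y b'] by simp
  qed
qed

text \<open>These are the starts of the maximal runs of consecutive descents. The end of the first
  part always is one, even if it is 1; this is the constant 1 in \<open>p_plus\<close>.\<close>

lemma p_plus_eq_card_descents:
  assumes "is_comp b"
  shows "p_plus b = card {d \<in> descents b. d - 1 \<notin> descents b}"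
proof (cases b)
  case Nil
  then show ?thesis by (simp add: p_plus_def)
next
  case (Cons x a)
  show ?thesis
  proof (cases "a = []")
    case True
    then show ?thesis using Cons by (simp add: p_plus_Cons descents_Cons)
  next
    case False
    let ?S = "{d \<in> descents a. d \<noteq> 1 \<and> d - 1 \<notin> descents a}"
    have D: "descents b = insert x ((+) x ` descents a)"
      using Cons False by (auto simp: descents_Cons)
    have x: "0 < x" using assms Cons by simp
    have a: "is_comp a" using assms Cons by simp
    have pos: "0 < d" if "d \<in> descents a" for d
      using descents_bounds[OF a] that by auto
    have fin: "finite ?S"
      using descents_bounds[OF a] by (auto intro: finite_subset)
    have "{d \<in> descents b. d - 1 \<notin> descents b} = insert x ((+) x ` ?S)"
    proof (rule set_eqI)
      fix d
      show "d \<in> {d \<in> descents b. d - 1 \<notin> descents b} \<longleftrightarrow> d \<in> insert x ((+) x ` ?S)"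
      proof (cases "d \<le> x")
        case True
        then show ?thesis using x pos unfolding D by (auto simp: image_iff dest: pos)
      next
        case False
        then obtain e where e: "d = x + Suc e" by (metis add_Suc_right less_imp_Suc_add not_le)
        then show ?thesis using x pos unfolding D by (auto simp: image_iff dest: pos)
      qed
    qed
    moreover have "x \<notin> (+) x ` ?S" using pos by auto
    ultimately have "card {d \<in> descents b. d - 1 \<notin> descents b} = Suc (card ?S)"
      using fin by (simp add: card_image)
    then show ?thesis
      using Cons False p_minus_eq_card_descents[OF a] by (simp add: p_plus_Cons)
  qed
qed

text \<open>Each part greater than 1 is recorded by the position just before its end, where a run of
  non-descents stops. The last part ends at the sum itself, which is not a descent; hence the
  separate case.\<close>

lemma long_parts_eq_card:
  assumes "is_comp a"
  shows "long_parts a = card {d \<in> {1..<sum_list a}. d \<notin> descents a \<and>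
    (Suc d = sum_list a \<or> Suc d \<in> descents a)}"
  using assms
proof (induction a)
  case Nil
  then show ?case by (simp add: long_parts_def)
next
  case (Cons x a)
  let ?S = "\<lambda>a. {d \<in> {1..<sum_list a}. d \<notin> descents a \<and>
    (Suc d = sum_list a \<or> Suc d \<in> descents a)}"
  have x: "0 < x" and a: "is_comp a" using Cons.prems by auto
  have pos: "0 < d" if "d \<in> descents a" for d
    using descents_bounds[OF a] that by auto
  have "?S (x # a) = (if 1 < x then {x - 1} else {}) \<union> (+) x ` ?S a"
  proof (cases "a = []")
    case True
    then show ?thesis using x by (auto simp: descents_Cons)
  next
    case False
    then have s: "0 < sum_list a" by (rule is_comp_sum_list_pos[OF a])
    have D: "descents (x # a) = insert x ((+) x ` descents a)"
      using False by (auto simp: descents_Cons)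
    show ?thesis
    proof (rule set_eqI)
      fix d
      show "d \<in> ?S (x # a) \<longleftrightarrow> d \<in> (if 1 < x then {x - 1} else {}) \<union> (+) x ` ?S a"
      proof (cases "d \<le> x")
        case True
        then show ?thesis using x pos s unfolding D by (auto simp: image_iff)
      next
        case False
        then obtain e where e: "d = x + Suc e" by (metis add_Suc_right less_imp_Suc_add not_le)
        then show ?thesis using x pos unfolding D by (auto simp: image_iff dest: pos)
      qed
    qed
  qed
  moreover have "x - 1 \<notin> (+) x ` ?S a" using x by auto
  moreover have "finite (?S a)" by simp
  ultimately have "card (?S (x # a)) = (if 1 < x then 1 else 0) + card (?S a)"
    by (simp add: card_insert_if card_image)
  then show ?case using Cons.IH[OF a] by (simp add: long_parts_def)
qed

text \<open>The map sending \<open>d\<close> to \<open>n - d\<close> carries descents of the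
  conjugate to non-descents of \<open>a\<close>, and starts of runs of the former to ends of runs of
  the latter.\<close>

lemma p_plus_conjugate:
  assumes "is_comp a"
  shows "p_plus (conjugate a) = long_parts a"
proof -
  define n where "n = sum_list a"
  let ?D = "descents a" and ?D' = "descents (conjugate a)"
  have mem: "d \<in> ?D' \<longleftrightarrow> 0 < d \<and> d < n \<and> n - d \<notin> ?D" for d
  proof -
    have "e < n" if "e \<in> ?D" for e
      using descents_bounds[OF assms] that by (auto simp: n_def)
    then have "n - d \<in> ?D \<longleftrightarrow> (\<exists>e. d = n - e \<and> e \<in> ?D)" if "0 < d" "d < n"
      using that by (metis diff_diff_cancel less_imp_le)
    then show ?thesis
      unfolding descents_conjugate n_def[symmetric] by auto
  qed
  let ?S = "{d \<in> {1..<n}. d \<notin> ?D \<and> (Suc d = n \<or> Suc d \<in> ?D)}"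
  have "bij_betw (\<lambda>d. n - d) ?S {d \<in> ?D'. d - 1 \<notin> ?D'}"
  proof (rule bij_betw_byWitness[where f' = "\<lambda>d. n - d"])
    show "(\<lambda>d. n - d) ` ?S \<subseteq> {d \<in> ?D'. d - 1 \<notin> ?D'}"
    proof (rule image_subsetI)
      fix d assume d: "d \<in> ?S"
      then have "n - (n - d) = d" "n - d - 1 = n - Suc d" "n - (n - Suc d) = Suc d" by auto
      with d show "n - d \<in> {d \<in> ?D'. d - 1 \<notin> ?D'}" unfolding mem_Collect_eq mem by auto
    qed
    show "(\<lambda>d. n - d) ` {d \<in> ?D'. d - 1 \<notin> ?D'} \<subseteq> ?S"
    proof (rule image_subsetI)
      fix d assume d: "d \<in> {d \<in> ?D'. d - 1 \<notin> ?D'}"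
      then have "0 < d" "d < n" by (auto simp: mem)
      \<comment> \<open>The run starting at \<open>d = 1\<close> corresponds to the last part of
        \<open>a\<close>; there \<open>d - 1\<close> is 0, and \<open>Suc (n - d)\<close> is
        \<open>n\<close>.\<close>
      then have "Suc (n - d) = n - (d - 1)" "Suc (n - d) = n \<longleftrightarrow> d - 1 = 0" by auto
      with d show "n - d \<in> ?S" unfolding mem_Collect_eq mem by auto
    qed
  qed (auto simp: mem)
  then show ?thesis
    using p_plus_eq_card_descents[OF is_comp_conjugate] long_parts_eq_card[OF assms]
    by (simp add: n_def bij_betw_same_card)
qed

section \<open>Quasi-shuffles and convolution of characters\<close>

text \<open>This is \<open>r\<close> evaluated at the product of the monomial functions of
  \<open>a\<close> and \<open>b\<close>.\<close>

definition qsum :: "(nat list \<Rightarrow> 'a::field) \<Rightarrow> nat list \<Rightarrow> nat list \<Rightarrow> 'a" where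
  "qsum r a b = sum_list (map r (qsh a b))"

lemma qsh_Nil_right: "qsh a [] = [a]"
  by (cases a) auto

lemma qsum_Nil [simp]: "qsum r [] b = r b" "qsum r a [] = r a"
  by (simp_all add: qsum_def qsh_Nil_right)

lemma qsum_Cons:
  "qsum r (x # a) (y # b) = qsum (\<lambda>c. r (x # c)) a (y # b) + qsum (\<lambda>c. r (y # c)) (x # a) b +
     qsum (\<lambda>c. r ((x + y) # c)) a b"
  by (simp add: qsum_def o_def)

lemma qsh_comp: "c \<in> set (qsh a b) \<Longrightarrow> is_comp a \<Longrightarrow> is_comp b \<Longrightarrow> is_comp c"
  by (induction a b arbitrary: c rule: qsh.induct) auto

lemma qsh_sum_list: "c \<in> set (qsh a b) \<Longrightarrow> sum_list c = sum_list a + sum_list b"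
  by (induction a b arbitrary: c rule: qsh.induct) auto

lemma qsum_cong:
  assumes "is_comp a" "is_comp b" "\<And>c. is_comp c \<Longrightarrow> r c = s c"
  shows "qsum r a b = qsum s a b"
  unfolding qsum_def using assms qsh_comp by (intro arg_cong[where f = sum_list] map_cong) auto

lemma qsum_add: "qsum (\<lambda>c. r c + s c) a b = qsum r a b + qsum s a b"
  by (simp add: qsum_def sum_list_addf)

lemma qsum_mult_left: "qsum (\<lambda>c. k * r c) a b = k * qsum r a b"
  by (simp add: qsum_def sum_list_const_mult)

text \<open>Convolution without the cut-off outside compositions, which makes it amenable to
  induction on the list.\<close>
definition deconc :: "(nat list \<Rightarrow> 'a::field) \<Rightarrow> (nat list \<Rightarrow> 'a) \<Rightarrow> nat list \<Rightarrow> 'a" where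
  "deconc r s a = (\<Sum>i\<le>length a. r (take i a) * s (drop i a))"

lemma conv_eq_deconc: "conv r s a = (if is_comp a then deconc r s a else 0)"
  by (simp add: conv_def deconc_def)

lemma deconc_Nil [simp]: "deconc r s [] = r [] * s []"
  by (simp add: deconc_def)

lemma deconc_Cons: "deconc r s (x # c) = r [] * s (x # c) + deconc (\<lambda>d. r (x # d)) s c"
  unfolding deconc_def by (simp add: sum.atMost_Suc_shift del: sum.atMost_Suc)

text \<open>The bialgebra axiom (the coproduct is multiplicative), tested against \<open>r \<otimes> s\<close>.\<close>
lemma qsum_deconc:
  "qsum (deconc r s) a b = (\<Sum>i\<le>length a. \<Sum>j\<le>length b.
     qsum r (take i a) (take j b) * qsum s (drop i a) (drop j b))"
proof (induction a b arbitrary: r rule: qsh.induct)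
  case (1 b)
  then show ?case by (simp add: deconc_def)
next
  case (2 x a)
  then show ?case by (simp add: deconc_def)
next
  case (3 x a y b)
  let ?la = "length a" and ?lb = "length b"
  let ?S = "\<lambda>i j. qsum s (drop i (x # a)) (drop j (y # b))"
  let ?x = "\<lambda>i j. qsum (\<lambda>c. r (x # c)) (take i a) (take j (y # b)) * ?S (Suc i) j"
  let ?y = "\<lambda>i j. qsum (\<lambda>c. r (y # c)) (take i (x # a)) (take j b) * ?S i (Suc j)"
  let ?xy = "\<lambda>i j. qsum (\<lambda>c. r ((x + y) # c)) (take i a) (take j b) * ?S (Suc i) (Suc j)"
  have "qsum (deconc r s) (x # a) (y # b) = r [] * qsum s (x # a) (y # b) +
      qsum (deconc (\<lambda>c. r (x # c)) s) a (y # b) + qsum (deconc (\<lambda>c. r (y # c)) s) (x # a) b +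
      qsum (deconc (\<lambda>c. r ((x + y) # c)) s) a b"
    unfolding qsum_Cons deconc_Cons qsum_add qsum_mult_left by (simp add: algebra_simps)
  also have "\<dots> = r [] * qsum s (x # a) (y # b) +
      (\<Sum>i\<le>?la. \<Sum>j\<le>Suc ?lb. ?x i j) + (\<Sum>i\<le>Suc ?la. \<Sum>j\<le>?lb. ?y i j) +
      (\<Sum>i\<le>?la. \<Sum>j\<le>?lb. ?xy i j)"
    unfolding 3 by simp
  \<comment> \<open>Peeling off \<open>j = 0\<close> and \<open>i = 0\<close> lets all three double
    sums run over the same rectangle, where \<open>qsum_Cons\<close> recombines them.\<close>
  also have "\<dots> = r [] * qsum s (x # a) (y # b) +
      (\<Sum>i\<le>?la. ?x i 0) + (\<Sum>j\<le>?lb. ?y 0 j) +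
      (\<Sum>i\<le>?la. \<Sum>j\<le>?lb. ?x i (Suc j) + ?y (Suc i) j + ?xy i j)"
    unfolding sum.atMost_Suc_shift sum.distrib by (simp add: algebra_simps)
  also have "\<dots> = (\<Sum>i\<le>Suc ?la. \<Sum>j\<le>Suc ?lb.
      qsum r (take i (x # a)) (take j (y # b)) * ?S i j)"
    unfolding sum.atMost_Suc_shift sum.distrib
    by (simp add: qsum_Cons sum.distrib algebra_simps)
  finally show ?case by simp
qed

lemma characterI:
  assumes "functional r" "r [] = 1"
    "\<And>a b. is_comp a \<Longrightarrow> is_comp b \<Longrightarrow> qsum r a b = r a * r b"
  shows "character r"
  using assms by (simp add: character_def qsum_def)

lemma character_qsum: "character r \<Longrightarrow> is_comp a \<Longrightarrow> is_comp b \<Longrightarrow> qsum r a b = r a * r b"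
  by (simp add: character_def qsum_def)

lemma is_comp_take: "is_comp a \<Longrightarrow> is_comp (take i a)"
  and is_comp_drop: "is_comp a \<Longrightarrow> is_comp (drop i a)"
  by (auto simp: is_comp_def dest: in_set_takeD in_set_dropD)

lemma qsum_conv:
  assumes "is_comp a" "is_comp b"
  shows "qsum (conv r s) a b = (\<Sum>i\<le>length a. \<Sum>j\<le>length b.
     qsum r (take i a) (take j b) * qsum s (drop i a) (drop j b))"
  unfolding qsum_deconc[symmetric] using assms by (intro qsum_cong) (auto simp: conv_eq_deconc)

lemma deconc_mult:
  "(\<Sum>i\<le>length a. \<Sum>j\<le>length b. (r (take i a) * r (take j b)) * (s (drop i a) * s (drop j b))) =
     deconc r s a * deconc r s b"
  by (simp add: deconc_def sum_product mult_ac)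

lemma character_conv:
  assumes "character r" "character s"
  shows "character (conv r s)"
proof (rule characterI)
  fix a b assume ab: "is_comp a" "is_comp b"
  then show "qsum (conv r s) a b = conv r s a * conv r s b"
    unfolding qsum_conv[OF ab]
    by (simp add: character_qsum[OF assms(1)] character_qsum[OF assms(2)] is_comp_take is_comp_drop
        deconc_mult conv_eq_deconc)
qed (use assms in \<open>auto simp: functional_def conv_def character_def\<close>)

text \<open>Expand the multiplicativity of \<open>conv m m\<close>, by induction on the total
  length. All pairs of cuts agree except the two extreme ones, which leave
  \<open>2 * qsum m a b = 2 * (m a * m b)\<close>.\<close>

lemma character_of_square:
  fixes m :: "nat list \<Rightarrow> 'a::field"
  assumes "(2::'a) \<noteq> 0" "functional m" "m [] = 1" "character (conv m m)"
  shows "character m"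
proof (rule characterI)
  fix a b assume "is_comp a" "is_comp b"
  then show "qsum m a b = m a * m b"
  proof (induction "length a + length b" arbitrary: a b rule: less_induct)
    case less
    show ?case
    proof (cases "a = [] \<or> b = []")
      case True
      then show ?thesis using assms(3) by auto
    next
      case False
      let ?I = "{..length a} \<times> {..length b}" and ?E = "{(0, 0), (length a, length b)}"
      let ?f = "\<lambda>(i, j). qsum m (take i a) (take j b) * qsum m (drop i a) (drop j b)"
      let ?g = "\<lambda>(i, j). (m (take i a) * m (take j b)) * (m (drop i a) * m (drop j b))"
      have split: "sum h ?I = h (0, 0) + h (length a, length b) + sum h (?I - ?E)"
        for h :: "nat \<times> nat \<Rightarrow> 'a"
        using False by (subst sum.subset_diff[of ?E]) auto
      have eq: "sum ?f (?I - ?E) = sum ?g (?I - ?E)"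
      proof (rule sum.cong)
        fix z assume z: "z \<in> ?I - ?E"
        obtain i j where ij: "z = (i, j)" by (cases z)
        have "qsum m (take i a) (take j b) = m (take i a) * m (take j b)"
          using z ij by (intro less.hyps) (use less.prems in \<open>auto simp: is_comp_take\<close>)
        moreover have "qsum m (drop i a) (drop j b) = m (drop i a) * m (drop j b)"
          using z ij by (intro less.hyps) (use less.prems False in \<open>auto simp: is_comp_drop\<close>)
        ultimately show "?f z = ?g z" by (simp add: ij)
      qed simp
      have "sum ?f ?I = qsum (conv m m) a b"
        unfolding qsum_conv[OF less.prems] by (simp add: sum.cartesian_product)
      also have "\<dots> = conv m m a * conv m m b"
        using assms(4) less.prems by (rule character_qsum)
      also have "\<dots> = sum ?g ?I"
        using less.prems by (simp add: conv_eq_deconc deconc_mult[symmetric] sum.cartesian_product)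
      finally have "sum ?f ?I = sum ?g ?I" .
      then have "2 * qsum m a b = 2 * (m a * m b)"
        unfolding split eq using assms(3) by simp
      then show ?thesis using assms(1) by simp
    qed
  qed
qed (use assms in auto)

lemma character_bar:
  assumes "character r"
  shows "character (bar r)"
proof (rule characterI)
  fix a b assume ab: "is_comp a" "is_comp b"
  have "qsum (bar r) a b = qsum (\<lambda>c. (-1) ^ (sum_list a + sum_list b) * r c) a b"
    unfolding qsum_def bar_def using qsh_sum_list
    by (intro arg_cong[where f = sum_list] map_cong) auto
  also have "\<dots> = bar r a * bar r b"
    using character_qsum[OF assms ab] by (simp add: qsum_mult_left bar_def power_add)
  finally show "qsum (bar r) a b = bar r a * bar r b" .
qed (use assms in \<open>auto simp: functional_def bar_def character_def\<close>)

lemma qsum_eps: "qsum eps a b = (eps a * eps b :: 'a::field)"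
proof -
  have "eps [] = (1::'a)" "eps (x # c) = (0::'a)" for x c by (simp_all add: eps_def)
  moreover have "qsum (\<lambda>c. 0::'a) a b = 0" for a b by (simp add: qsum_def)
  ultimately show ?thesis by (cases a; cases b) (simp_all add: qsum_Cons)
qed

text \<open>On nonempty compositions \<open>zeta\<close> is \<open>eps\<close> of the tail. Hence
  only the quasi-shuffles with merged first parts can contribute, and they do so exactly when both
  factors have length 1.\<close>

lemma character_zeta: "character zeta"
proof (rule characterI)
  fix a b assume ab: "is_comp a" "is_comp b"
  show "qsum zeta a b = (zeta a * zeta b :: 'a)"
  proof (cases "a = [] \<or> b = []")
    case True
    then show ?thesis by (auto simp: zeta_def)
  next
    case False
    then obtain x a' y b' where xy: "a = x # a'" "b = y # b'" by (meson list.exhaust)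
    have z: "zeta (x # c) = (eps c :: 'a)" if "0 < x" "is_comp c" for x c
      using that by (auto simp: zeta_def eps_def)
    have "qsum zeta a b = (qsum eps a' (y # b') + qsum eps (x # a') b' + qsum eps a' b' :: 'a)"
      unfolding xy qsum_Cons using ab xy by (intro arg_cong2[where f = "(+)"] qsum_cong) (auto simp: z)
    also have "\<dots> = zeta a * zeta b"
      using ab xy unfolding qsum_eps by (simp add: z) (simp add: eps_def)
    finally show ?thesis .
  qed
qed (auto simp: functional_def zeta_def)

section \<open>Uniqueness of convolution inverses and of the even-odd factorisation\<close>

lemma conv_split:
  assumes "is_comp a" "a \<noteq> []"
  shows "conv r s a = r [] * s a + r a * s [] +
    (\<Sum>i\<in>{0<..<length a}. r (take i a) * s (drop i a))"
proof -
  have "{..length a} = insert 0 (insert (length a) {0<..<length a})" by auto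
  then show ?thesis using assms by (simp add: conv_def)
qed

text \<open>For nonempty \<open>a\<close>, the value \<open>s a\<close> enters
  \<open>conv r s a\<close> with coefficient \<open>r [] = 1\<close>, and all other values of
  \<open>s\<close> there belong to shorter lists.\<close>

lemma conv_inv_unique:
  assumes "functional s" "functional t" "r [] = 1" "conv r s = eps" "conv r t = eps"
  shows "s = t"
proof
  fix a
  show "s a = t a"
  proof (induction "length a" arbitrary: a rule: less_induct)
    case less
    have st: "conv r s a = conv r t a" using assms by simp
    have shorter: "length (take i a) < length a" "length (drop i a) < length a"
      if "i \<in> {0<..<length a}" for i using that by auto
    consider "\<not> is_comp a" | "a = []" | "is_comp a" "a \<noteq> []" by blast
    then show ?case
    proof cases
      case 1
      then show ?thesis using assms by (simp add: functional_def)
    next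
      case 2
      then show ?thesis using st assms(3) by (simp add: conv_def)
    next
      case 3
      have "(\<Sum>i\<in>{0<..<length a}. r (take i a) * s (drop i a)) =
          (\<Sum>i\<in>{0<..<length a}. r (take i a) * t (drop i a))"
        by (intro sum.cong refl) (simp only: less[OF shorter(1)] less[OF shorter(2)])
      moreover have "s [] = t []" using less[of "[]"] 3 by simp
      ultimately show ?thesis using st 3 assms(3) by (simp add: conv_split)
    qed
  qed
qed

text \<open>By induction on the length, the product fixes \<open>p a + m a\<close>. In even degree
  oddness of \<open>m\<close> fixes \<open>2 * m a\<close>; in odd degree evenness of
  \<open>p\<close> makes \<open>p a\<close> vanish.\<close>

lemma even_odd_unique:
  fixes p :: "nat list \<Rightarrow> 'a::field"
  assumes "(2::'a) \<noteq> 0"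
    and "functional p" "functional m" "p [] = 1" "m [] = 1" "even_fun p" "odd_fun m"
    and "functional p'" "functional m'" "p' [] = 1" "m' [] = 1" "even_fun p'" "odd_fun m'"
    and "conv p m = conv p' m'"
  shows "p = p' \<and> m = m'"
proof -
  have "p a = p' a \<and> m a = m' a" for a
  proof (induction "length a" arbitrary: a rule: less_induct)
    case less
    have shorter: "length (take i a) < length a" "length (drop i a) < length a"
      if "i \<in> {0<..<length a}" for i using that by auto
    consider "\<not> is_comp a" | "a = []" | "is_comp a" "a \<noteq> []" by blast
    then show ?case
    proof cases
      case 1
      then show ?thesis using assms by (simp add: functional_def)
    next
      case 2
      then show ?thesis using assms by simp
    next
      case 3
      have "(\<Sum>i\<in>{0<..<length a}. p (take i a) * m (drop i a)) =
          (\<Sum>i\<in>{0<..<length a}. p' (take i a) * m' (drop i a))"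
        by (intro sum.cong refl) (simp only: less[OF shorter(1)] less[OF shorter(2)])
      moreover have "conv p m a = conv p' m' a" using assms by simp
      ultimately have sum: "m a + p a = m' a + p' a"
        unfolding conv_split[OF 3] using assms by simp
      show ?thesis
      proof (cases "even (sum_list a)")
        case True
        have "(\<Sum>i\<in>{0<..<length a}. bar m (take i a) * m (drop i a)) =
          (\<Sum>i\<in>{0<..<length a}. bar m' (take i a) * m' (drop i a))"
          unfolding bar_def by (intro sum.cong refl) (simp only: less[OF shorter(1)] less[OF shorter(2)])
        moreover have "conv (bar m) m a = conv (bar m') m' a"
          using assms by (simp add: odd_fun_def conv_inverse_pair_def)
        ultimately have "2 * m a = 2 * m' a"
          unfolding conv_split[OF 3] using assms True by (simp add: bar_def)
        then show ?thesis using sum assms(1) by simp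
      next
        case False
        have z: "q a = 0" if "even_fun q" for q :: "nat list \<Rightarrow> 'a"
        proof -
          have "bar q a = q a" using that by (simp add: even_fun_def)
          then have "- q a = q a" using False unfolding bar_def by simp
          then have "2 * q a = 0" unfolding mult_2 by (simp only: neg_eq_iff_add_eq_0)
          then show ?thesis using assms(1) by simp
        qed
        show ?thesis using sum z[OF assms(6)] z[OF assms(12)] by simp
      qed
    qed
  qed
  then show ?thesis by auto
qed

section \<open>Functionals depending on the parities of the parts\<close>

unbundle fps_syntax

text \<open>This is \<open>P f\<close> in the notation of the introduction, and
  \<open>odd_hd_fun f\<close> below is \<open>Q f\<close>.\<close>

definition parity_fun :: "'a::field fps \<Rightarrow> nat list \<Rightarrow> 'a" where
  "parity_fun f b = (if is_comp b then parity_wt (fps_nth f) b else 0)"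

definition odd_hd_fun :: "'a::field fps \<Rightarrow> nat list \<Rightarrow> 'a" where
  "odd_hd_fun f b = (if b = [] \<or> odd (hd b) then parity_fun f b else 0)"

lemma odd_hd_fun_Cons: "odd_hd_fun f (x # b) = (if odd x then parity_fun f (x # b) else 0)"
  by (simp add: odd_hd_fun_def)

lemma parity_wt_Nil [simp]: "parity_wt f [] = f 0"
  by (simp add: parity_wt_def evens_def odds_def)

text \<open>The analogue of \<open>deconc_Cons\<close> for the Cauchy product.\<close>

lemma fps_mult_nth_Suc: "(f * g) $ Suc k = f $ 0 * g $ Suc k + (fps_shift 1 f * g) $ k"
  unfolding fps_mult_nth by (subst sum.atLeast0_atMost_Suc_shift) simp

text \<open>If \<open>b\<close> has \<open>k\<close> odd parts, only the cut at the end and those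
  just before an odd part count. Each number of odd parts from 0 to \<open>k\<close> lies to the
  left of exactly one of them, so the sum is a Cauchy product.\<close>

lemma deconc_parity_wt:
  assumes "is_comp b"
  shows "deconc (parity_wt (fps_nth f)) (odd_hd_fun g) b = parity_wt (fps_nth (f * g)) b"
  using assms
proof (induction b arbitrary: f)
  case Nil
  then show ?case by (simp add: odd_hd_fun_def parity_fun_def)
next
  case (Cons x b)
  show ?case
  proof (cases "even x")
    case True
    have "deconc (\<lambda>d. - parity_wt (fps_nth f) d) (odd_hd_fun g) b =
        - deconc (parity_wt (fps_nth f)) (odd_hd_fun g) b"
      by (simp add: deconc_def sum_negf)
    then show ?thesis using True Cons
      by (simp add: deconc_Cons parity_wt_Cons odd_hd_fun_Cons)
  next
    case False
    have shift: "(\<lambda>k. f $ Suc k) = fps_nth (fps_shift 1 f)" by auto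
    have "deconc (parity_wt (\<lambda>k. f $ Suc k)) (odd_hd_fun g) b =
        parity_wt (fps_nth (fps_shift 1 f * g)) b"
      unfolding shift using Cons by simp
    then show ?thesis using False Cons.prems
      by (simp add: deconc_Cons parity_wt_Cons odd_hd_fun_Cons parity_fun_def)
        (simp add: parity_wt_def fps_mult_nth_Suc algebra_simps)
  qed
qed

lemma conv_parity_fun: "conv (parity_fun f) (odd_hd_fun g) = parity_fun (f * g)"
proof
  fix b
  show "conv (parity_fun f) (odd_hd_fun g) b = parity_fun (f * g) b"
  proof (cases "is_comp b")
    case True
    then have "deconc (parity_fun f) (odd_hd_fun g) b =
        deconc (parity_wt (fps_nth f)) (odd_hd_fun g) b"
      by (simp add: deconc_def parity_fun_def is_comp_take)
    with True show ?thesis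
      by (simp add: conv_eq_deconc deconc_parity_wt parity_fun_def)
  qed (simp add: conv_def parity_fun_def)
qed

text \<open>If \<open>b\<close> starts with an odd part, so does every nonempty initial segment, and
  \<open>conv_parity_fun\<close> applies. If it starts with an even part, the cut at 0 kills the
  right factor and every other cut the left one.\<close>

lemma conv_odd_hd_fun: "conv (odd_hd_fun f) (odd_hd_fun g) = odd_hd_fun (f * g)"
proof
  fix b
  show "conv (odd_hd_fun f) (odd_hd_fun g) b = odd_hd_fun (f * g) b"
  proof (cases "b = [] \<or> odd (hd b)")
    case True
    then have "odd_hd_fun f (take i b) = parity_fun f (take i b)" for i
      by (cases "i = 0") (auto simp: odd_hd_fun_def)
    then have "conv (odd_hd_fun f) (odd_hd_fun g) b = conv (parity_fun f) (odd_hd_fun g) b"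
      by (simp add: conv_def)
    with True show ?thesis by (simp add: conv_parity_fun odd_hd_fun_def)
  next
    case False
    then have "odd_hd_fun f (take i b) * odd_hd_fun g (drop i b) = 0" for i
      by (cases "i = 0") (auto simp: odd_hd_fun_def)
    then have "conv (odd_hd_fun f) (odd_hd_fun g) b = 0"
      unfolding conv_def by (simp only: sum.neutral_const if_cancel)
    with False show ?thesis by (simp add: odd_hd_fun_def)
  qed
qed

text \<open>The degree is congruent modulo 2 to the number of odd parts; hence \<open>bar\<close>
  replaces \<open>X\<close> by \<open>-X\<close> in the series.\<close>

lemma neg_one_power_sum_list: "(-1) ^ sum_list b = ((-1) ^ odds b :: 'a::field)"
  by (induction b) (auto simp: odds_def power_add minus_one_power_iff)

lemma bar_odd_hd_fun:
  assumes "\<And>k. g $ k = (-1) ^ k * f $ k"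
  shows "bar (odd_hd_fun f) = odd_hd_fun g"
  by (rule ext) (simp add: bar_def odd_hd_fun_def parity_fun_def parity_wt_def
      neg_one_power_sum_list assms)

lemma bar_parity_fun:
  assumes "\<And>k. g $ k = (-1) ^ k * f $ k"
  shows "bar (parity_fun f) = parity_fun g"
  by (rule ext) (simp add: bar_def parity_fun_def parity_wt_def neg_one_power_sum_list assms)

lemma functional_odd_hd_fun: "functional (odd_hd_fun f)"
  by (auto simp: functional_def parity_fun_def odd_hd_fun_def)

lemma odd_hd_fun_1: "odd_hd_fun 1 = eps"
proof
  fix b
  show "odd_hd_fun 1 b = eps b"
    by (cases b) (auto simp: odd_hd_fun_def eps_def parity_fun_def parity_wt_Cons,
        simp add: parity_wt_def)
qed

lemma onF_parity_fun:
  assumes "is_comp a"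
  shows "onF (parity_fun f) a =
    (diff2 ^^ long_parts a) (fps_nth f) (sum_list a - 2 * long_parts a)"
proof -
  have "onF (parity_fun f) a = onF (parity_wt (fps_nth f)) a"
    unfolding onF_def by (rule sum.cong) (auto simp: parity_fun_def refines_def)
  then show ?thesis using onF_parity_wt[OF assms, of "fps_nth f" 0] by simp
qed

text \<open>Only refinements with odd first part count, so \<open>x\<close> contributes a shift and
  no difference, even if it is greater than 1. This is why the odd part is governed by
  \<open>p_minus\<close> of the reversal.\<close>

lemma onF_odd_hd_fun_Cons:
  assumes "is_comp (x # a)"
  shows "onF (odd_hd_fun f) (x # a) =
    (diff2 ^^ long_parts a) (fps_nth f) (sum_list (x # a) - 2 * long_parts a)"
proof -
  obtain z where z: "x = Suc z" using assms by (cases x) auto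
  have "onF (odd_hd_fun f) (x # a) = odd_hd_sum (\<lambda>k. f $ Suc k) (x # a)"
    unfolding onF_def odd_hd_sum_def
  proof (rule sum.cong)
    fix b assume b: "b \<in> {b. refines b (x # a)}"
    with assms obtain y b' where "b = y # b'" by (auto elim: refines_Cons_imp)
    with b show "odd_hd_fun f b = (if odd (hd b) then parity_wt (\<lambda>k. f $ Suc k) (tl b) else 0)"
      by (auto simp: odd_hd_fun_def parity_fun_def parity_wt_Cons dest: refines_imp_comp)
  qed simp
  also have "\<dots> = onF (parity_wt (\<lambda>k. f $ (k + x))) a"
    using assms z by (simp add: odd_hd_sum_Cons)
  also have "\<dots> = (diff2 ^^ long_parts a) (fps_nth f) (sum_list a - 2 * long_parts a + x)"
    using assms by (intro onF_parity_wt) simp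
  also have "sum_list a - 2 * long_parts a + x = sum_list (x # a) - 2 * long_parts a"
    using long_parts_bound[of a] by simp
  finally show ?thesis .
qed

section \<open>The even and odd parts of the inverse of the universal character\<close>

text \<open>The series \<open>(1 - X\<^sup>2)\<close> to the power \<open>-1/2\<close>, and \<open>1 / (1 + X)\<close>.\<close>
definition inv_sqrt_fps :: "'a::field fps" where
  "inv_sqrt_fps = Abs_fps (\<lambda>n. if even n then of_nat (superC 0 (n div 2)) / 4 ^ (n div 2) else 0)"

definition alt_fps :: "'a::field fps" where
  "alt_fps = Abs_fps (\<lambda>n. (-1) ^ n)"

lemma alt_fps_mult: "alt_fps * (1 + fps_X) = (1 :: 'a::field fps)"
proof (rule fps_ext)
  fix n
  show "(alt_fps * (1 + fps_X)) $ n = (1 :: 'a fps) $ n"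
    by (cases n) (simp_all add: alt_fps_def distrib_left)
qed

text \<open>The right-hand side is \<open>1 / (1 - X^2)\<close>. Odd coefficients vanish by parity,
  and at \<open>2 * N\<close> the powers of 4 combine to the \<open>4 ^ N\<close> of
  \<open>superC_convolution\<close>.\<close>

lemma inv_sqrt_fps_square:
  assumes "(2::'a::field) \<noteq> 0"
  shows "inv_sqrt_fps * inv_sqrt_fps = (Abs_fps (\<lambda>n. if even n then 1 else 0) :: 'a fps)"
proof (rule fps_ext)
  fix n
  have "(4::'a) = 2 * 2" by simp
  with assms have 4: "(4::'a) \<noteq> 0" by (metis mult_eq_0_iff)
  let ?s = "\<lambda>i. inv_sqrt_fps $ i :: 'a"
  show "(inv_sqrt_fps * inv_sqrt_fps) $ n = (Abs_fps (\<lambda>n. if even n then 1 else 0) :: 'a fps) $ n"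
  proof (cases "even n")
    case False
    then have "?s i * ?s (n - i) = 0" if "i \<in> {0..n}" for i
      using that by (auto simp: inv_sqrt_fps_def)
    then have "(inv_sqrt_fps * inv_sqrt_fps) $ n = (0::'a)"
      unfolding fps_mult_nth by (rule sum.neutral[OF ballI])
    then show ?thesis using False by simp
  next
    case True
    then obtain N where N: "n = 2 * N" by auto
    have "(inv_sqrt_fps * inv_sqrt_fps) $ n = (\<Sum>i\<le>n. ?s i * ?s (n - i))"
      by (simp add: fps_mult_nth atMost_atLeast0)
    also have "\<dots> = (\<Sum>i\<in>(*) 2 ` {..N}. ?s i * ?s (n - i))"
      by (rule sum.mono_neutral_right) (auto simp: N inv_sqrt_fps_def elim!: evenE)
    also have "\<dots> = (\<Sum>i\<le>N. ?s (2 * i) * ?s (2 * (N - i)))"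
      by (subst sum.reindex) (auto simp: inj_on_def N diff_mult_distrib2)
    also have "\<dots> = (\<Sum>i\<le>N. of_nat (superC 0 i * superC 0 (N - i)) / 4 ^ N)"
    proof (rule sum.cong)
      fix i assume "i \<in> {..N}"
      then have "(4::'a) ^ N = 4 ^ i * 4 ^ (N - i)" by (simp flip: power_add)
      then show "?s (2 * i) * ?s (2 * (N - i)) = of_nat (superC 0 i * superC 0 (N - i)) / 4 ^ N"
        by (simp add: inv_sqrt_fps_def)
    qed simp
    also have "\<dots> = of_nat (\<Sum>i\<le>N. superC 0 i * superC 0 (N - i)) / 4 ^ N"
      by (simp add: sum_divide_distrib)
    also have "\<dots> = 1" unfolding superC_convolution using 4 by simp
    finally show ?thesis using True by simp
  qed
qed

text \<open>This is \<open>(1 - X) / (1 - X^2) = 1 / (1 + X)\<close>, the factorisation behind the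
  even and odd parts.\<close>

lemma inv_sqrt_fps_square_mult:
  assumes "(2::'a::field) \<noteq> 0"
  shows "inv_sqrt_fps * (inv_sqrt_fps * (1 - fps_X)) = (alt_fps :: 'a fps)"
proof (rule fps_ext)
  fix n
  show "(inv_sqrt_fps * (inv_sqrt_fps * (1 - fps_X))) $ n = (alt_fps :: 'a fps) $ n"
    unfolding mult.assoc[symmetric] inv_sqrt_fps_square[OF assms]
    by (cases n) (simp_all add: alt_fps_def right_diff_distrib minus_one_power_iff)
qed

text \<open>In characteristic other than 2 the series is a square root of
  \<open>(1 - X) / (1 + X)\<close>, and replacing \<open>X\<close> by \<open>-X\<close> inverts
  it.\<close>

definition odd_char :: "nat list \<Rightarrow> 'a::field" where
  "odd_char = odd_hd_fun (inv_sqrt_fps * (1 - fps_X))"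

definition even_char :: "nat list \<Rightarrow> 'a::field" where
  "even_char = parity_fun inv_sqrt_fps"

definition zeta_inv :: "nat list \<Rightarrow> 'a::field" where
  "zeta_inv = parity_fun alt_fps"

lemma zeta_inv_eq: "zeta_inv b = (if is_comp b then (-1) ^ length b else 0 :: 'a::field)"
proof -
  have "evens b + odds b = length b"
    using sum_length_filter_compl[of even b] by (simp add: evens_def odds_def)
  then show ?thesis
    by (simp add: zeta_inv_def parity_fun_def parity_wt_def alt_fps_def flip: power_add)
qed

lemma zeta_Nil [simp]: "zeta [] = 1"
  by (simp add: zeta_def)

lemma zeta_sums:
  fixes g :: "nat list \<Rightarrow> 'a::field"
  assumes "is_comp b"
  shows "deconc zeta g b = g b + (if b = [] then 0 else g (tl b))"
proof (cases b)
  case (Cons x b')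
  have z: "deconc (\<lambda>d. zeta (x # d)) g b' = g b'"
  proof -
    have "deconc (\<lambda>d. zeta (x # d)) g b' = (\<Sum>i\<le>length b'. if i = 0 then g b' else 0)"
      unfolding deconc_def
      by (rule sum.cong) (use assms Cons in \<open>auto simp: zeta_def\<close>)
    then show ?thesis by simp
  qed
  show ?thesis using Cons by (simp add: deconc_Cons z)
qed (simp add: zeta_def)

lemma conv_zeta_zeta_inv: "conv zeta zeta_inv = (eps :: _ \<Rightarrow> 'a::field)"
proof
  fix b
  show "conv zeta zeta_inv b = (eps b :: 'a)"
    by (cases b) (auto simp: conv_eq_deconc zeta_sums zeta_inv_eq eps_def)
qed

lemma conv_zeta_inv_zeta: "conv zeta_inv zeta = (eps :: _ \<Rightarrow> 'a::field)"
proof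
  fix b
  \<comment> \<open>The factor \<open>k\<close> is there for the induction: removing a first part
    multiplies \<open>zeta_inv\<close> by -1.\<close>
  have "deconc (\<lambda>c. k * zeta_inv c) zeta b = (k * eps b :: 'a)" if "is_comp b" for k
    using that
  proof (induction b arbitrary: k)
    case Nil
    then show ?case by (simp add: zeta_inv_eq zeta_def eps_def)
  next
    case (Cons x b)
    have "deconc (\<lambda>c. k * zeta_inv (x # c)) zeta b = deconc (\<lambda>c. (- k) * zeta_inv c) zeta b"
      unfolding deconc_def using Cons.prems
      by (intro sum.cong) (auto simp: zeta_inv_eq is_comp_take)
    then have "deconc (\<lambda>c. k * zeta_inv (x # c)) zeta b = - k * eps b"
      using Cons.IH[of "- k"] Cons.prems by simp
    then show ?case using Cons.prems
      unfolding deconc_Cons by (auto simp: zeta_def eps_def zeta_inv_eq)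
  qed
  from this[of 1] show "conv zeta_inv zeta b = (eps b :: 'a)"
    by (auto simp: conv_eq_deconc eps_def)
qed

lemma conv_inv_zeta: "conv_inv zeta = (zeta_inv :: _ \<Rightarrow> 'a::field)"
  unfolding conv_inv_def
proof (rule the_equality)
  show "functional zeta_inv \<and> conv_inverse_pair zeta (zeta_inv :: _ \<Rightarrow> 'a)"
    by (simp add: conv_inverse_pair_def conv_zeta_zeta_inv conv_zeta_inv_zeta
        functional_def zeta_inv_eq)
  then show "s = zeta_inv" if "functional s \<and> conv_inverse_pair zeta s" for s :: "_ \<Rightarrow> 'a"
    using that by (intro conv_inv_unique[of s zeta_inv zeta]) (auto simp: conv_inverse_pair_def)
qed

text \<open>In the quasi-shuffle recursion both unmerged families contribute the wanted sign and the
  merged one its opposite: \<open>1 + 1 - 1 = 1\<close>.\<close>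

lemma character_zeta_inv: "character (zeta_inv :: _ \<Rightarrow> 'a::field)"
proof (rule characterI)
  fix a b assume ab: "is_comp a" "is_comp b"
  have "qsum (\<lambda>c. (-1) ^ length c) a b = ((-1) ^ (length a + length b) :: 'a)"
    by (induction a b rule: qsh.induct)
      (simp_all add: qsum_Cons qsum_mult_left[of "-1", simplified])
  moreover have "qsum zeta_inv a b = (qsum (\<lambda>c. (-1) ^ length c) a b :: 'a)"
    using ab by (intro qsum_cong) (auto simp: zeta_inv_eq)
  ultimately show "qsum zeta_inv a b = (zeta_inv a * zeta_inv b :: 'a)"
    using ab by (simp add: zeta_inv_eq power_add)
qed (auto simp: functional_def zeta_inv_eq)

lemma inv_sqrt_fps_0: "inv_sqrt_fps $ 0 = 1"
  by (simp add: inv_sqrt_fps_def superC_0_0)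

lemma odd_char_Nil: "odd_char [] = 1"
  by (simp add: odd_char_def odd_hd_fun_def parity_fun_def inv_sqrt_fps_0)

lemma bar_odd_char: "bar odd_char = odd_hd_fun (inv_sqrt_fps * (1 + fps_X))"
  unfolding odd_char_def
proof (rule bar_odd_hd_fun)
  fix k
  show "(inv_sqrt_fps * (1 + fps_X)) $ k = (- 1) ^ k * (inv_sqrt_fps * (1 - fps_X)) $ k"
    by (cases k) (simp_all add: distrib_left right_diff_distrib inv_sqrt_fps_def minus_one_power_iff)
qed

lemma even_even_char: "even_fun even_char"
  unfolding even_fun_def even_char_def
  by (rule bar_parity_fun) (simp add: inv_sqrt_fps_def)

lemma inv_sqrt_fps_bar:
  assumes "(2::'a::field) \<noteq> 0"
  shows "(inv_sqrt_fps * (1 - fps_X)) * (inv_sqrt_fps * (1 + fps_X)) = (1 :: 'a fps)"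
proof -
  have "(inv_sqrt_fps * (1 - fps_X)) * (inv_sqrt_fps * (1 + fps_X)) =
      (inv_sqrt_fps * (inv_sqrt_fps * (1 - fps_X))) * (1 + fps_X :: 'a fps)"
    by (simp add: mult_ac)
  then show ?thesis unfolding inv_sqrt_fps_square_mult[OF assms] alt_fps_mult .
qed

lemma odd_odd_char:
  assumes "(2::'a::field) \<noteq> 0"
  shows "odd_fun (odd_char :: _ \<Rightarrow> 'a)"
  using inv_sqrt_fps_bar[OF assms]
  unfolding odd_fun_def conv_inverse_pair_def bar_odd_char unfolding odd_char_def
  by (simp add: conv_odd_hd_fun odd_hd_fun_1 mult.commute)

text \<open>The square of the odd part is \<open>bar zeta * zeta_inv\<close>, which is visibly a character.\<close>
lemma character_odd_char:
  assumes "(2::'a::field) \<noteq> 0"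
  shows "character (odd_char :: _ \<Rightarrow> 'a)"
proof (rule character_of_square[OF assms])
  let ?h = "alt_fps * (1 - fps_X) :: 'a fps"
  have "(inv_sqrt_fps * (1 - fps_X)) * (inv_sqrt_fps * (1 - fps_X)) =
      (inv_sqrt_fps * (inv_sqrt_fps * (1 - fps_X))) * (1 - fps_X :: 'a fps)"
    by (simp only: mult_ac)
  also have "\<dots> = ?h" unfolding inv_sqrt_fps_square_mult[OF assms] ..
  finally have sq: "conv odd_char odd_char = odd_hd_fun ?h"
    unfolding odd_char_def conv_odd_hd_fun by (rule arg_cong)
  have "odd_hd_fun ?h = conv (bar zeta) (zeta_inv :: _ \<Rightarrow> 'a)"
  proof
    fix b
    show "odd_hd_fun ?h b = conv (bar zeta) (zeta_inv :: _ \<Rightarrow> 'a) b"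
    proof (cases "is_comp b \<and> b \<noteq> []")
      case False
      then show ?thesis
        by (auto simp: odd_hd_fun_def parity_fun_def conv_eq_deconc bar_def zeta_def
            zeta_inv_eq alt_fps_def)
    next
      case True
      then obtain x c where b: "b = x # c" by (cases b) auto
      have "deconc (\<lambda>d. bar zeta (x # d)) zeta_inv c =
          (\<Sum>i\<le>length c. if i = 0 then (-1) ^ x * zeta_inv c else (0::'a))"
        unfolding deconc_def
        by (rule sum.cong) (use True b in \<open>auto simp: zeta_def bar_def\<close>)
      \<comment> \<open>Only the cuts before and after the first part \<open>x\<close> survive.
        Their terms cancel for even \<open>x\<close> and coincide for odd \<open>x\<close>, as
        \<open>odd_hd_fun\<close> requires.\<close>
      then have conv: "conv (bar zeta) (zeta_inv :: _ \<Rightarrow> 'a) b =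
          (-1) ^ Suc (length c) + (-1) ^ x * (-1) ^ length c"
        using True b by (simp add: conv_eq_deconc deconc_Cons)
          (simp add: zeta_inv_eq bar_def zeta_def)
      \<comment> \<open>The series is
        \<open>(1 - X) / (1 + X) = 1 - 2 X + 2 X^2 - ...\<close>.\<close>
      have h: "?h $ Suc k = 2 * (-1) ^ Suc k" for k
        by (simp add: right_diff_distrib alt_fps_def)
      have len: "evens c + odds c = length c"
        using sum_length_filter_compl[of even c] by (simp add: evens_def odds_def)
      show ?thesis
      proof (cases "odd x")
        case True
        then have "odd_hd_fun ?h b = (-1) ^ evens c * (2 * (-1) ^ Suc (odds c))"
          using \<open>is_comp b \<and> b \<noteq> []\<close> b
          by (simp only: odd_hd_fun_def parity_fun_def parity_wt_Cons h) (simp add: parity_wt_def)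
        also have "\<dots> = 2 * (-1) ^ Suc (length c)"
          by (simp add: len[symmetric] power_add)
        finally show ?thesis using True unfolding conv by simp
      next
        case False
        then show ?thesis using b unfolding conv by (simp add: odd_hd_fun_def)
      qed
    qed
  qed
  then show "character (conv odd_char odd_char :: _ \<Rightarrow> 'a)"
    unfolding sq by (simp add: character_conv character_bar character_zeta character_zeta_inv)
qed (simp_all add: odd_char_Nil, simp add: odd_char_def functional_odd_hd_fun)

lemma conv_even_odd_char:
  assumes "(2::'a::field) \<noteq> 0"
  shows "conv even_char odd_char = (zeta_inv :: _ \<Rightarrow> 'a)"
  unfolding even_char_def odd_char_def zeta_inv_def conv_parity_fun
    inv_sqrt_fps_square_mult[OF assms] ..

text \<open>Since \<open>bar odd_char\<close> is the inverse of \<open>odd_char\<close>, the even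
  part is the product of the characters \<open>zeta_inv\<close> and
  \<open>bar odd_char\<close>.\<close>

lemma character_even_char:
  assumes "(2::'a::field) \<noteq> 0"
  shows "character (even_char :: _ \<Rightarrow> 'a)"
proof -
  have "alt_fps * (inv_sqrt_fps * (1 + fps_X)) = (inv_sqrt_fps * (alt_fps * (1 + fps_X)) :: 'a fps)"
    by (simp only: mult_ac)
  also have "\<dots> = inv_sqrt_fps" unfolding alt_fps_mult by simp
  finally have "even_char = conv zeta_inv (bar odd_char :: _ \<Rightarrow> 'a)"
    unfolding bar_odd_char zeta_inv_def conv_parity_fun even_char_def by (rule arg_cong[OF sym])
  then show ?thesis
    using character_conv[OF character_zeta_inv character_bar[OF character_odd_char[OF assms]]]
    by (simp only:)
qed

lemma even_odd_parts_zeta_inv: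
  assumes "(2::'a::field) \<noteq> 0"
  shows "even_odd_parts (zeta_inv :: _ \<Rightarrow> 'a) = (even_char, odd_char)"
  unfolding even_odd_parts_def
proof (rule the_equality)
  show "case (even_char, odd_char :: _ \<Rightarrow> 'a) of (p, m) \<Rightarrow>
      character p \<and> character m \<and> even_fun p \<and> odd_fun m \<and> conv p m = zeta_inv"
    using assms by (simp add: character_even_char character_odd_char even_even_char odd_odd_char
        conv_even_odd_char)
next
  fix z :: "(nat list \<Rightarrow> 'a) \<times> (nat list \<Rightarrow> 'a)"
  assume z: "case z of (p, m) \<Rightarrow>
      character p \<and> character m \<and> even_fun p \<and> odd_fun m \<and> conv p m = zeta_inv"
  have "fst z = even_char \<and> snd z = odd_char"
    by (rule even_odd_unique[OF assms])
      (use z character_even_char[OF assms] character_odd_char[OF assms] even_even_char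
          odd_odd_char[OF assms] conv_even_odd_char[OF assms]
        in \<open>auto simp: character_def\<close>)
  then show "z = (even_char, odd_char)" by (simp add: prod_eq_iff)
qed

theorem theorem8p7:
  fixes a :: "nat list" and n :: nat
  assumes char2: "(2::'a::field) \<noteq> 0"
    and comp: "is_comp a" and sum: "sum_list a = n"
  shows "onF (odd_part (conv_inv (zeta :: nat list \<Rightarrow> 'a))) a
           = (-1) ^ (n + p_minus (rev a)) / 2 ^ (2 * (n div 2))
             * of_nat (superC (p_minus (rev a)) (n div 2 - p_minus (rev a)))
     \<and> onF (even_part (conv_inv (zeta :: nat list \<Rightarrow> 'a))) a
           = (if even n then (-1) ^ p_plus (conjugate a) / 2 ^ n
                 * of_nat (superC (p_plus (conjugate a)) (n div 2 - p_plus (conjugate a)))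
              else 0)"
proof
  have parts: "odd_part (conv_inv (zeta :: nat list \<Rightarrow> 'a)) = odd_char"
    "even_part (conv_inv (zeta :: nat list \<Rightarrow> 'a)) = even_char"
    by (simp_all add: odd_part_def even_part_def conv_inv_zeta even_odd_parts_zeta_inv[OF char2])
  have four: "(2::'a) ^ (2 * k) = 4 ^ k" for k by (simp add: power_mult)
  have n: "n = 2 * (n div 2) + n mod 2" by simp
  show "onF (odd_part (conv_inv (zeta :: nat list \<Rightarrow> 'a))) a
           = (-1) ^ (n + p_minus (rev a)) / 2 ^ (2 * (n div 2))
             * of_nat (superC (p_minus (rev a)) (n div 2 - p_minus (rev a)))"
  proof (cases a)
    case Nil
    then show ?thesis
      using sum by (simp add: parts onF_def refines_Nil odd_char_Nil p_minus_def superC_0_0)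
  next
    case (Cons x b)
    have q: "p_minus (rev a) = long_parts b"
      by (simp add: Cons p_minus_snoc) (simp add: long_parts_def rev_filter[symmetric])
    define q where "q = long_parts b"
    have "2 * q \<le> n" using long_parts_bound[of b] Cons sum by (simp add: q_def)
    then have nq: "n - 2 * q = 2 * (n div 2 - q) + n mod 2" "q + (n div 2 - q) = n div 2"
      using n by presburger+
    let ?f = "inv_sqrt_fps * (1 - fps_X) :: 'a fps"
    \<comment> \<open>The factor \<open>1 - X\<close> copies each even coefficient, with opposite
      sign, to the next odd index; this is the sign \<open>(-1) ^ n\<close>.\<close>
    have coeff: "?f $ (2 * r + n mod 2) = (-1) ^ n * of_nat (superC 0 r) / 4 ^ r" for r
      by (cases "even n")
        (simp_all add: right_diff_distrib inv_sqrt_fps_def odd_iff_mod_2_eq_one[THEN iffD1]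
          even_iff_mod_2_eq_zero[THEN iffD1])
    have "onF odd_char a = (diff2 ^^ q) (fps_nth ?f) (2 * (n div 2 - q) + n mod 2)"
      using onF_odd_hd_fun_Cons[of x b ?f] Cons comp sum unfolding nq(1)[symmetric]
      by (simp add: odd_char_def q_def)
    also have "\<dots> = (-1) ^ n * (-1) ^ q * of_nat (superC q (n div 2 - q)) / 4 ^ (q + (n div 2 - q))"
      by (rule diff2_funpow_superC[OF char2 coeff])
    finally show ?thesis unfolding parts q four nq(2) q_def[symmetric] by (simp add: power_add)
  qed
  define q where "q = long_parts a"
  have q: "p_plus (conjugate a) = q"
    by (simp add: p_plus_conjugate[OF comp] q_def)
  have "2 * q \<le> n" using long_parts_bound[of a] sum by (simp add: q_def)
  then have nq: "n - 2 * q = 2 * (n div 2 - q) + n mod 2" "q + (n div 2 - q) = n div 2"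
    using n by presburger+
  \<comment> \<open>For odd \<open>n\<close> only odd-indexed coefficients enter, and these are
    zero; the factor \<open>?e\<close> treats both parities at once.\<close>
  let ?e = "if even n then 1 else 0 :: 'a"
  have coeff: "inv_sqrt_fps $ (2 * r + n mod 2) = ?e * of_nat (superC 0 r) / 4 ^ r" for r
    by (cases "even n")
      (simp_all add: inv_sqrt_fps_def odd_iff_mod_2_eq_one[THEN iffD1]
          even_iff_mod_2_eq_zero[THEN iffD1])
  have "onF even_char a = (diff2 ^^ q) (fps_nth (inv_sqrt_fps :: 'a fps)) (2 * (n div 2 - q) + n mod 2)"
    using onF_parity_fun[OF comp] sum unfolding nq(1)[symmetric] by (simp add: even_char_def q_def)
  also have "\<dots> = ?e * (-1) ^ q * of_nat (superC q (n div 2 - q)) / 4 ^ (q + (n div 2 - q))"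
    by (rule diff2_funpow_superC[OF char2 coeff])
  finally have *: "onF even_char a = ?e * (-1) ^ q * of_nat (superC q (n div 2 - q)) / 4 ^ (n div 2)"
    unfolding nq(2) .
  have "(4::'a) ^ (n div 2) = 2 ^ n" if "even n"
    using four[of "n div 2"] that by simp
  then show "onF (even_part (conv_inv (zeta :: nat list \<Rightarrow> 'a))) a
           = (if even n then (-1) ^ p_plus (conjugate a) / 2 ^ n
                 * of_nat (superC (p_plus (conjugate a)) (n div 2 - p_plus (conjugate a)))
              else 0)"
    unfolding parts q * by simp
qed

end
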